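(* Assume that there exists an upper semicontinuous multivalued function $S:[0,T]\times\mathbb{R}^n\rightrightarrows\mathbb{R}^2$ with nonempty images satisfying the following conditions: (S1) $S(T,x)=\{(\sigma_1(x),\sigma_2(x))\}$ for all $x\in\mathbb{R}^n$; (S2) for all $(t,x)\in[0,T]\times\mathbb{R}^n$, $(J_1,J_2)\in S(t,x)$, $u\in P$ and $t_+\in[t,T]$ there exist a motion $y^2(\cdot)\in\mathrm{Sol}^2(t,x;u)$ and a pair $(J_1',J_2')\in S(t_+,y^2(t_+))$ such that $J_1\geq J_1'$; (S3) for all $(t,x)\in[0,T]\times\mathbb{R}^n$, $(J_1,J_2)\in S(t,x)$, $v\in Q$ and $t_+\in[t,T]$ there exist a motion $y^1(\cdot)\in\mathrm{Sol}^1(t,x;v)$ and a pair $(J_1'',J_2'')\in S(t_+,y^1(t_+))$ such that $J_2\geq J_2''$; (S4) for all $(t,x)\in[0,T]\times\mathbb{R}^n$, $(J_1,J_2)\in S(t,x)$ and $t_+\in[t,T]$ there exists a motion $y^{(c)}(\cdot)\in\mathrm{Sol}(t,x)$ such that $(J_1,J_2)\in S(t_+,y^{(c)}(t_+))$. Then for any selector $(\hat J_1,\hat J_2)$ of $S$ (that is, any function on $[0,T]\times\mathbb{R}^n$ with $(\hat J_1(t,x),\hat J_2(t,x))\in S(t,x)$ for all $(t,x)$) and any compact set $G\subset[0,T]\times\mathbb{R}^n$ there exists a Control with Guide Nash equilibrium on $G$ such that the corresponding Nash equilibrium payoff at each $(t_0,x_0)\in G$ is $(\hat J_1(t_0,x_0),\hat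 J_2(t_0,x_0))$.
   Context: Game. Consider the two-player differential game $\dot x=f(t,x,u)+g(t,x,v)$, $t\in[0,T]$, $x\in\mathbb{R}^n$, $u\in P$ (control of player I), $v\in Q$ (control of player II). Player $i$ wants to maximize $\sigma_i(x(T))$, $i=1,2$. The sets $P$ and $Q$ are (nonempty) compact; $f,g,\sigma_1,\sigma_2$ are continuous; $f$ and $g$ are Lipschitz continuous with respect to $x$ and satisfy the sublinear growth condition with respect to $x$. Let $\mathcal{U}$ (resp. $\mathcal{V}$) be the set of measurable functions $[0,T]\to P$ (resp. $[0,T]\to Q$). For $u\in\mathcal{U}$, $v\in\mathcal{V}$, $x(\cdot,t_0,x_0,u,v)$ is the solution of $\dot x(t)=f(t,x(t),u(t))+g(t,x(t),v(t))$, $x(t_0)=x_0$; an element of $P$ or $Q$ in place of $u$ or $v$ means the constant control. Sets of motions. With closures taken in the space of continuous vector functions on $[0,T]$: $\mathrm{Sol}^1(t_*,x_*;v_* ):=\mathrm{cl}\{x(\cdot,t_*,x_*,u,v_* ):u\in\mathcal{U}\}$ for $v_*\in Q$; $\mathrm{Sol}^2(t_*,x_*;u_* ):=\mathrm{cl}\{x(\cdot,t_*,x_*,u_*,v):v\in\mathcal{V}\}$ for $u_*\in P$; $\mathrm{Sol}(t_*,x_* ):=\mathrm{cl}\{x(\cdot,t_*,x_*,u,v):u\in\mathcal{U},v\in\mathcal{V}\}$. Upper semicontinuity of a multivalued function is understood in the closed-graph sense: if $(t_l,x_l)\to(t,x)$, $J^l\in S(t_l,x_l)$ and $J^l\to J$,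 then $J\in S(t,x)$. Control with guide strategies. A control with guide strategy of player I is a triple of functions $U=(u,\psi^1,\chi^1)$ such that for some natural $m$: $u:[0,T]\times\mathbb{R}^n\times\mathbb{R}^m\to P$, $\psi^1:[0,T]\times[0,T]\times\mathbb{R}^n\times\mathbb{R}^m\to\mathbb{R}^m$, $\chi^1:[0,T]\times\mathbb{R}^n\to\mathbb{R}^m$. A control with guide strategy of player II is a triple $V=(v,\psi^2,\chi^2)$ defined analogously, with $v$ taking values in $Q$ (the guide dimension may be different). For a partition $\Delta=\{t_k\}_{k=0}^r$ of $[t_0,T]$, $d(\Delta)$ is its mesh (largest step). Motions. (a) For $v[\cdot]\in\mathcal{V}$, $x^1[\cdot,t_0,x_0,U,\Delta,v[\cdot]]$ is the solution of the dynamics on $[t_0,T]$ with $x[t_0]=x_0$, where player II uses $v[\cdot]$ and player I uses the constant control $u(t_k,x_k,w^1_k)$ on $[t_k,t_{k+1})$, with $x_k=x[t_k]$, $w^1_0=\chi^1(t_0,x_0)$, $w^1_k=\psi^1(t_k,t_{k-1},x_{k-1},w^1_{k-1})$ for $k\ge1$. (b) For $u[\cdot]\in\mathcal{U}$, $x^2[\cdot,t_0,x_0,V,\Delta,u[\cdot]]$ is defined symmetrically: player I uses $u[\cdot]$ and player II uses $v(t_k,x_k,w^2_k)$ on $[t_k,t_{k+1})$, with $w^2_0=\chi^2(t_0,x_0)$, $w^2_k=\psi^2(t_k,t_{k-1},x_{k-1},w^2_{k-1})$. (c) $x^{(c)}[\cdot,t_0,x_0,U,V,\Delta]$ is the solution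 with $x[t_0]=x_0$ where on $[t_k,t_{k+1})$ player I uses $u(t_k,x_k,w^1_k)$ and player II uses $v(t_k,x_k,w^2_k)$, with $w^i_0=\chi^i(t_0,x_0)$, $w^i_{k+1}=\psi^i(t_{k+1},t_k,x_k,w^i_k)$, $i=1,2$. Equilibrium. For $G\subset[0,T]\times\mathbb{R}^n$, a pair $(U^*,V^* )$ of control with guide strategies is a Control with Guide Nash equilibrium on $G$ if for all $(t_0,x_0)\in G$: $$\lim_{\delta\downarrow0}\sup\{\sigma_1(x^2[T,t_0,x_0,V^*,\Delta,u[\cdot]]):d(\Delta)\le\delta,\ u[\cdot]\in\mathcal{U}\}\le\lim_{\delta\downarrow0}\inf\{\sigma_1(x^{(c)}[T,t_0,x_0,U^*,V^*,\Delta]):d(\Delta)\le\delta\},$$ $$\lim_{\delta\downarrow0}\sup\{\sigma_2(x^1[T,t_0,x_0,U^*,\Delta,v[\cdot]]):d(\Delta)\le\delta,\ v[\cdot]\in\mathcal{V}\}\le\lim_{\delta\downarrow0}\inf\{\sigma_2(x^{(c)}[T,t_0,x_0,U^*,V^*,\Delta]):d(\Delta)\le\delta\},$$ where $\Delta$ ranges over partitions of $[t_0,T]$. The corresponding Nash equilibrium payoff at $(t_0,x_0)$ is the pair whose $i$-th component is $\lim_{\delta\downarrow0}\inf\{\sigma_i(x^{(c)}[T,t_0,x_0,U^*,V^*,\Delta]):d(\Delta)\le\delta\}$, $i=1,2$. *)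

theory Defs
  imports "HOL-Analysis.Analysis"
begin

section \<open>Controls and trajectories\<close>

definition controls :: "real \<Rightarrow> 'p::topological_space set \<Rightarrow> (real \<Rightarrow> 'p) set" where
  "controls T P = lebesgue_on {0..T} \<rightarrow>\<^sub>M restrict_space borel P"

text \<open>Since controls are merely measurable in time, solutions are understood in the sense of
  Caratheodory, i.e. through the integral equation. Quantifying over all subintervals makes the
  predicate independent of where the initial condition is imposed, so that it covers
  backward solutions as well.\<close>

definition solves_on ::
  "(real \<Rightarrow> 'x::euclidean_space \<Rightarrow> 'p \<Rightarrow> 'x) \<Rightarrow> (real \<Rightarrow> 'x \<Rightarrow> 'q \<Rightarrow> 'x)
    \<Rightarrow> (real \<Rightarrow> 'p) \<Rightarrow> (real \<Rightarrow> 'q) \<Rightarrow> real \<Rightarrow> real \<Rightarrow> (real \<Rightarrow> 'x) \<Rightarrow> bool" where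
  "solves_on f g u v a b x \<longleftrightarrow>
     (\<forall>s t. a \<le> s \<longrightarrow> s \<le> t \<longrightarrow> t \<le> b \<longrightarrow>
       ((\<lambda>\<tau>. f \<tau> (x \<tau>) (u \<tau>) + g \<tau> (x \<tau>) (v \<tau>)) has_integral (x t - x s)) {s..t})"

text \<open>Trajectories are extensional on \<open>{0..T}\<close>, so that they are points of the
  metric space \<open>cfunspace\<close> of continuous functions on \<open>{0..T}\<close>. Under the standing assumptions
  the set below is a singleton.\<close>

definition trajectories ::
  "real \<Rightarrow> (real \<Rightarrow> 'x::euclidean_space \<Rightarrow> 'p \<Rightarrow> 'x) \<Rightarrow> (real \<Rightarrow> 'x \<Rightarrow> 'q \<Rightarrow> 'x)
    \<Rightarrow> real \<Rightarrow> 'x \<Rightarrow> (real \<Rightarrow> 'p) \<Rightarrow> (real \<Rightarrow> 'q) \<Rightarrow> (real \<Rightarrow> 'x) set" where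
  "trajectories T f g t0 x0 u v =
     {x \<in> extensional {0..T}. x t0 = x0 \<and> solves_on f g u v 0 T x}"

abbreviation uniform_closure :: "real \<Rightarrow> (real \<Rightarrow> 'x::euclidean_space) set \<Rightarrow> (real \<Rightarrow> 'x) set" where
  "uniform_closure T X \<equiv>
     mtopology_of (cfunspace (top_of_set {0..T}) euclidean_metric) closure_of X"

definition Sol1 ::
  "real \<Rightarrow> (real \<Rightarrow> 'x::euclidean_space \<Rightarrow> 'p::topological_space \<Rightarrow> 'x)
    \<Rightarrow> (real \<Rightarrow> 'x \<Rightarrow> 'q \<Rightarrow> 'x) \<Rightarrow> 'p set \<Rightarrow> real \<Rightarrow> 'x \<Rightarrow> 'q \<Rightarrow> (real \<Rightarrow> 'x) set" where
  "Sol1 T f g P t x v =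
     uniform_closure T (\<Union>u\<in>controls T P. trajectories T f g t x u (\<lambda>_. v))"

definition Sol2 ::
  "real \<Rightarrow> (real \<Rightarrow> 'x::euclidean_space \<Rightarrow> 'p \<Rightarrow> 'x)
    \<Rightarrow> (real \<Rightarrow> 'x \<Rightarrow> 'q::topological_space \<Rightarrow> 'x) \<Rightarrow> 'q set \<Rightarrow> real \<Rightarrow> 'x \<Rightarrow> 'p \<Rightarrow> (real \<Rightarrow> 'x) set" where
  "Sol2 T f g Q t x u =
     uniform_closure T (\<Union>v\<in>controls T Q. trajectories T f g t x (\<lambda>_. u) v)"

definition Sol ::
  "real \<Rightarrow> (real \<Rightarrow> 'x::euclidean_space \<Rightarrow> 'p::topological_space \<Rightarrow> 'x)
    \<Rightarrow> (real \<Rightarrow> 'x \<Rightarrow> 'q::topological_space \<Rightarrow> 'x) \<Rightarrow> 'p set \<Rightarrow> 'q set \<Rightarrow> real \<Rightarrow> 'x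
    \<Rightarrow> (real \<Rightarrow> 'x) set" where
  "Sol T f g P Q t x =
     uniform_closure T (\<Union>u\<in>controls T P. \<Union>v\<in>controls T Q. trajectories T f g t x u v)"

section \<open>Hypotheses on the data and on the multivalued function\<close>

definition lipschitz_in_state ::
  "real \<Rightarrow> 'p set \<Rightarrow> (real \<Rightarrow> 'x::euclidean_space \<Rightarrow> 'p \<Rightarrow> 'x) \<Rightarrow> bool" where
  "lipschitz_in_state T P f \<longleftrightarrow> (\<exists>L. \<forall>t\<in>{0..T}. \<forall>u\<in>P. L-lipschitz_on UNIV (\<lambda>x. f t x u))"

definition sublinear_growth ::
  "real \<Rightarrow> 'p set \<Rightarrow> (real \<Rightarrow> 'x::euclidean_space \<Rightarrow> 'p \<Rightarrow> 'x) \<Rightarrow> bool" where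
  "sublinear_growth T P f \<longleftrightarrow>
     (\<exists>C. \<forall>t\<in>{0..T}. \<forall>x. \<forall>u\<in>P. norm (f t x u) \<le> C * (1 + norm x))"

definition closed_graph_on ::
  "real \<Rightarrow> (real \<Rightarrow> 'x::euclidean_space \<Rightarrow> (real \<times> real) set) \<Rightarrow> bool" where
  "closed_graph_on T S \<longleftrightarrow>
     (\<forall>tl xl Jl t x J.
        (\<forall>l::nat. tl l \<in> {0..T} \<and> Jl l \<in> S (tl l) (xl l)) \<longrightarrow> t \<in> {0..T} \<longrightarrow>
        tl \<longlonglongrightarrow> t \<longrightarrow> xl \<longlonglongrightarrow> x \<longrightarrow> Jl \<longlonglongrightarrow> J \<longrightarrow>
        J \<in> S t x)"

section \<open>Controls with guide\<close>

text \<open>The guide dimension \<open>m\<close> is part of a strategy, hence cannot be a type. The library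
  represents \<open>\<real>\<^sup>m\<close> for a number \<open>m\<close> as the carrier of \<open>Euclidean_space m\<close>, the functions
  \<open>w :: nat \<Rightarrow> real\<close> with \<open>w i = 0\<close> for \<open>i \<ge> m\<close>.\<close>

record ('x, 'c) guide_strategy =
  ctrl :: "real \<Rightarrow> 'x \<Rightarrow> (nat \<Rightarrow> real) \<Rightarrow> 'c"
  guide_step :: "real \<Rightarrow> real \<Rightarrow> 'x \<Rightarrow> (nat \<Rightarrow> real) \<Rightarrow> nat \<Rightarrow> real"
  guide_init :: "real \<Rightarrow> 'x \<Rightarrow> nat \<Rightarrow> real"

definition control_with_guide :: "real \<Rightarrow> 'c set \<Rightarrow> ('x, 'c) guide_strategy \<Rightarrow> bool" where
  "control_with_guide T C U \<longleftrightarrow>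
     (\<exists>m. (\<forall>t\<in>{0..T}. \<forall>x. \<forall>w\<in>topspace (Euclidean_space m). ctrl U t x w \<in> C) \<and>
          (\<forall>t\<in>{0..T}. \<forall>s\<in>{0..T}. \<forall>x. \<forall>w\<in>topspace (Euclidean_space m).
             guide_step U t s x w \<in> topspace (Euclidean_space m)) \<and>
          (\<forall>t\<in>{0..T}. \<forall>x. guide_init U t x \<in> topspace (Euclidean_space m)))"

text \<open>A partition is given by its number of steps \<open>r\<close> and its nodes \<open>\<tau> 0 < \<dots> < \<tau> r\<close>. The case
  \<open>r = 0\<close> is the only partition of a degenerate interval, needed for the initial time \<open>T\<close>; its
  mesh is \<open>0\<close>.\<close>

definition is_partition :: "real \<Rightarrow> real \<Rightarrow> nat \<Rightarrow> (nat \<Rightarrow> real) \<Rightarrow> bool" where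
  "is_partition a b r \<tau> \<longleftrightarrow> \<tau> 0 = a \<and> \<tau> r = b \<and> (\<forall>k<r. \<tau> k < \<tau> (Suc k))"

definition mesh :: "nat \<Rightarrow> (nat \<Rightarrow> real) \<Rightarrow> real" where
  "mesh r \<tau> = Max (insert 0 ((\<lambda>k. \<tau> (Suc k) - \<tau> k) ` {..<r}))"

primrec guide :: "('x, 'c) guide_strategy \<Rightarrow> (nat \<Rightarrow> real) \<Rightarrow> (real \<Rightarrow> 'x) \<Rightarrow> nat \<Rightarrow> nat \<Rightarrow> real" where
  "guide U \<tau> x 0 = guide_init U (\<tau> 0) (x (\<tau> 0))"
| "guide U \<tau> x (Suc k) = guide_step U (\<tau> (Suc k)) (\<tau> k) (x (\<tau> k)) (guide U \<tau> x k)"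

definition step_ctrl :: "('x, 'c) guide_strategy \<Rightarrow> (nat \<Rightarrow> real) \<Rightarrow> (real \<Rightarrow> 'x) \<Rightarrow> nat \<Rightarrow> 'c" where
  "step_ctrl U \<tau> x k = ctrl U (\<tau> k) (x (\<tau> k)) (guide U \<tau> x k)"

text \<open>Motions generated by guide strategies on a partition of \<open>{t0..T}\<close>; only the values on that
  interval are constrained. \<open>motion1\<close>: player I uses \<open>U\<close>, player II an arbitrary control \<open>v\<close>;
  \<open>motion2\<close>: player II uses \<open>V\<close>, player I an arbitrary control \<open>u\<close>; \<open>motionc\<close>: both
  players use guide strategies.\<close>

definition motion1 where
  "motion1 f g t0 x0 U r \<tau> v x \<longleftrightarrow> x t0 = x0 \<and>
     (\<forall>k<r. solves_on f g (\<lambda>_. step_ctrl U \<tau> x k) v (\<tau> k) (\<tau> (Suc k)) x)"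

definition motion2 where
  "motion2 f g t0 x0 V r \<tau> u x \<longleftrightarrow> x t0 = x0 \<and>
     (\<forall>k<r. solves_on f g u (\<lambda>_. step_ctrl V \<tau> x k) (\<tau> k) (\<tau> (Suc k)) x)"

definition motionc where
  "motionc f g t0 x0 U V r \<tau> x \<longleftrightarrow> x t0 = x0 \<and>
     (\<forall>k<r. solves_on f g (\<lambda>_. step_ctrl U \<tau> x k) (\<lambda>_. step_ctrl V \<tau> x k) (\<tau> k) (\<tau> (Suc k)) x)"

section \<open>Equilibrium\<close>

text \<open>Suprema, infima and limits are taken in \<open>ereal\<close>, where they exist unconditionally (the
  limits by monotonicity in \<open>\<delta>\<close>).\<close>

definition payoff_vs1 where
  "payoff_vs1 T f g Q \<sigma> U t0 x0 =
     Lim (at_right 0) (\<lambda>\<delta>::real. Sup {ereal (\<sigma> (x T)) | x r \<tau> v.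
        is_partition t0 T r \<tau> \<and> mesh r \<tau> \<le> \<delta> \<and> v \<in> controls T Q \<and>
        motion1 f g t0 x0 U r \<tau> v x})"

definition payoff_vs2 where
  "payoff_vs2 T f g P \<sigma> V t0 x0 =
     Lim (at_right 0) (\<lambda>\<delta>::real. Sup {ereal (\<sigma> (x T)) | x r \<tau> u.
        is_partition t0 T r \<tau> \<and> mesh r \<tau> \<le> \<delta> \<and> u \<in> controls T P \<and>
        motion2 f g t0 x0 V r \<tau> u x})"

definition consistent_payoff where
  "consistent_payoff T f g \<sigma> U V t0 x0 =
     Lim (at_right 0) (\<lambda>\<delta>::real. Inf {ereal (\<sigma> (x T)) | x r \<tau>.
        is_partition t0 T r \<tau> \<and> mesh r \<tau> \<le> \<delta> \<and> motionc f g t0 x0 U V r \<tau> x})"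

definition guide_nash_equilibrium ::
  "real \<Rightarrow> (real \<Rightarrow> 'x::euclidean_space \<Rightarrow> 'p::topological_space \<Rightarrow> 'x)
    \<Rightarrow> (real \<Rightarrow> 'x \<Rightarrow> 'q::topological_space \<Rightarrow> 'x) \<Rightarrow> 'p set \<Rightarrow> 'q set
    \<Rightarrow> ('x \<Rightarrow> real) \<Rightarrow> ('x \<Rightarrow> real) \<Rightarrow> (real \<times> 'x) set
    \<Rightarrow> ('x, 'p) guide_strategy \<Rightarrow> ('x, 'q) guide_strategy \<Rightarrow> bool" where
  "guide_nash_equilibrium T f g P Q \<sigma>1 \<sigma>2 G U V \<longleftrightarrow>
     control_with_guide T P U \<and> control_with_guide T Q V \<and>
     (\<forall>(t0, x0)\<in>G.
        payoff_vs2 T f g P \<sigma>1 V t0 x0 \<le> consistent_payoff T f g \<sigma>1 U V t0 x0 \<and>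
        payoff_vs1 T f g Q \<sigma>2 U t0 x0 \<le> consistent_payoff T f g \<sigma>2 U V t0 x0)"

definition nash_payoff where
  "nash_payoff T f g \<sigma>1 \<sigma>2 U V t0 x0 =
     (consistent_payoff T f g \<sigma>1 U V t0 x0, consistent_payoff T f g \<sigma>2 U V t0 x0)"

end

theory Submission
  imports Defs
begin

text \<open>The pair \<open>J\<close> that the selector picks at \<open>(t0, x0)\<close> has to be the outcome of joint play, and neither
player may gain by deviating. Both players carry in their guides the same auxiliary motion \<open>w\<close>, the
plan: by (S4) it can be moved from node to node of the partition so that \<open>J\<close> remains in
\<open>S t (w t)\<close>. At each node a player applies the extremal shift, i.e. it takes the control that minimizes
the inner product of \<open>x - w\<close> with its own part of the dynamics. If both players do so, then over a
step of length \<open>h\<close> the squared distance of \<open>x\<close> and \<open>w\<close> is multiplied by at most \<open>1 + 4 * K * h\<close> and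
increased by at most \<open>h * \<phi> h\<close>, where \<open>\<phi> h\<close> tends to \<open>0\<close> with \<open>h\<close> (\<open>extremal_shift\<close>,
\<open>error_rate_exists\<close>). Hence \<open>x T\<close> is close to \<open>w T\<close> on a fine partition (\<open>agreement\<close>), and (S1) says
that the payoffs at \<open>w T\<close> are \<open>J\<close>.

A strategy does not know the mesh of the partition, so it cannot recognize a deviation by comparing
the distance of \<open>x\<close> and \<open>w\<close> with a threshold chosen in advance. Instead the guide accumulates the error
\<open>D\<close> by the recursion \<open>D' = (1 + 4 * K * h) * D + h * \<phi> h\<close>; without a deviation \<open>D\<close>
bounds the squared distance, and a larger distance raises an alarm. When this happens, \<open>x\<close> is still
near the plan, since at the previous node the squared distance was at most the small number \<open>D\<close>
and speeds are bounded. From then on the guide is moved by (S2) or (S3) against the constant control of the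
opponent that maximizes the inner product of \<open>x - w\<close> with the opponent's part of the dynamics.
Against this worst case the extremal shift keeps \<open>x\<close> near \<open>w\<close> whatever the opponent really
does, and the opponent's entry of the pair attached to \<open>w\<close> never increases (\<open>pursuit\<close>). So the opponent
ends up with at most its entry of \<open>J\<close>, up to an error that vanishes with the mesh.

The roles of the players are symmetric. The strategy and its punishing effect are therefore studied
from the point of view of one player, in the locale \<open>tracking\<close>, which is then instantiated twice,
with \<open>f\<close> and \<open>g\<close> exchanged the second time; \<open>game\<close> combines the two instances.\<close>

section \<open>Solutions of the controlled system\<close>

lemma solves_on_commute: "solves_on f g u v = solves_on g f v u"
  by (intro ext) (simp add: solves_on_def add.commute)

lemma solves_on_continuous:
  assumes "solves_on f g u v a b x"
  shows "continuous_on {a..b} x"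
proof (cases "a \<le> b")
  case True
  let ?F = "\<lambda>\<tau>. f \<tau> (x \<tau>) (u \<tau>) + g \<tau> (x \<tau>) (v \<tau>)"
  have *: "(?F has_integral (x t - x a)) {a..t}" if "t \<in> {a..b}" for t
    using assms that unfolding solves_on_def by auto
  have "?F integrable_on {a..b}"
    using *[of b] True by auto
  then have "continuous_on {a..b} (\<lambda>t. x a + integral {a..t} ?F)"
    by (intro continuous_intros indefinite_integral_continuous_1)
  then show ?thesis
  proof (rule continuous_on_eq)
    show "x a + integral {a..t} ?F = x t" if "t \<in> {a..b}" for t
      using integral_unique[OF *[OF that]] by simp
  qed
qed simp

lemma solves_on_subinterval:
  "solves_on f g u v a b x \<Longrightarrow> a \<le> a' \<Longrightarrow> b' \<le> b \<Longrightarrow> solves_on f g u v a' b' x"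
  unfolding solves_on_def by (meson order_trans)

lemma solves_on_cong:
  assumes "solves_on f g u v a b x" "\<And>t. t \<in> {a..b} \<Longrightarrow> x t = y t"
  shows "solves_on f g u v a b y"
  unfolding solves_on_def
proof (intro allI impI)
  fix s t assume st: "a \<le> s" "s \<le> t" "t \<le> b"
  then have "((\<lambda>\<tau>. f \<tau> (x \<tau>) (u \<tau>) + g \<tau> (x \<tau>) (v \<tau>)) has_integral (x t - x s)) {s..t}"
    using assms(1) unfolding solves_on_def by blast
  then have "((\<lambda>\<tau>. f \<tau> (y \<tau>) (u \<tau>) + g \<tau> (y \<tau>) (v \<tau>)) has_integral (x t - x s)) {s..t}"
    by (rule has_integral_eq[rotated]) (use st assms(2) in simp)
  then show "((\<lambda>\<tau>. f \<tau> (y \<tau>) (u \<tau>) + g \<tau> (y \<tau>) (v \<tau>)) has_integral (y t - y s)) {s..t}"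
    using st assms(2) by simp
qed

lemma gronwall:
  fixes \<phi> :: "real \<Rightarrow> real"
  assumes "continuous_on {a..b} \<phi>" and "t \<in> {a..b}"
    and le: "\<And>s. s \<in> {a..b} \<Longrightarrow> \<phi> s \<le> c + k * integral {a..s} \<phi>" and "0 \<le> k"
  shows "\<phi> t \<le> c * exp (k * (t - a))"
proof -
  \<comment> \<open>The hypothesis says that this function has a nonpositive derivative.\<close>
  define F where "F s = (c + k * integral {a..s} \<phi>) * exp (- (k * (s - a)))" for s
  have "F t \<le> F a"
  proof (rule DERIV_nonpos_imp_decreasing_open[of a t F])
    show "a \<le> t" using assms by simp
    show "continuous_on {a..t} F"
      unfolding F_def using assms(1,2)
      by (intro continuous_intros indefinite_integral_continuous_1 integrable_continuous_real)
         (auto elim: continuous_on_subset)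
    fix s assume s: "a < s" "s < t"
    have "((\<lambda>u. integral {a..u} \<phi>) has_real_derivative \<phi> s) (at s within {a..b})"
      using integral_has_real_derivative[OF assms(1), of s] s assms(2) by auto
    moreover have "at s within {a..b} = at s"
      using s assms(2) by (intro at_within_interior) auto
    ultimately have "((\<lambda>u. integral {a..u} \<phi>) has_real_derivative \<phi> s) (at s)"
      by simp
    then have "(F has_real_derivative
        (k * \<phi> s) * exp (- (k * (s - a))) + (c + k * integral {a..s} \<phi>) * (exp (- (k * (s - a))) * (- k))) (at s)"
      unfolding F_def by (auto intro!: derivative_eq_intros)
    moreover have "(k * \<phi> s) * exp (- (k * (s - a))) + (c + k * integral {a..s} \<phi>) * (exp (- (k * (s - a))) * (- k))
        = k * exp (- (k * (s - a))) * (\<phi> s - (c + k * integral {a..s} \<phi>))"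
      by (simp add: algebra_simps)
    moreover have "\<dots> \<le> 0"
      using le[of s] s assms(2,4) by (intro mult_nonneg_nonpos) auto
    ultimately show "\<exists>y. (F has_real_derivative y) (at s) \<and> y \<le> 0" by metis
  qed
  moreover have "F a = c" by (simp add: F_def)
  ultimately have "(c + k * integral {a..t} \<phi>) * exp (- (k * (t - a))) \<le> c"
    by (simp add: F_def)
  then have "(c + k * integral {a..t} \<phi>) \<le> c * exp (k * (t - a))"
    by (simp add: exp_minus divide_simps)
  then show ?thesis using le[OF assms(2)] by linarith
qed

text \<open>The Picard operator contracts the supremum distance by the factor \<open>L * (b - a)\<close>, so on a short
interval the Banach fixed point theorem applies without a weighted norm. The fixed point is sought
among the bounded continuous functions on the whole line; composing with the projection onto
\<open>{a..b}\<close> makes the operator act there.\<close>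

lemma picard_local_solution:
  fixes h :: "real \<Rightarrow> 'x::euclidean_space \<Rightarrow> 'x"
  assumes cont: "continuous_on ({a..b} \<times> UNIV) (\<lambda>(t, x). h t x)"
    and lip: "\<And>t x y. t \<in> {a..b} \<Longrightarrow> norm (h t x - h t y) \<le> L * norm (x - y)"
    and "a \<le> b" "0 \<le> L" "L * (b - a) < 1"
  obtains x where "x a = x0"
    and "\<And>s t. a \<le> s \<Longrightarrow> s \<le> t \<Longrightarrow> t \<le> b \<Longrightarrow> ((\<lambda>\<tau>. h \<tau> (x \<tau>)) has_integral (x t - x s)) {s..t}"
proof -
  \<comment> \<open>the projection onto the interval\<close>
  define p where "p t = max a (min b t)" for t
  have p: "continuous_on UNIV p" "p t \<in> {a..b}" "t \<in> {a..b} \<Longrightarrow> p t = t" for t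
    using \<open>a \<le> b\<close> by (auto simp: p_def intro!: continuous_intros)
  have cont': "continuous_on {s..t} (\<lambda>\<tau>. h \<tau> (\<phi> \<tau>))"
    if "continuous_on {a..b} \<phi>" "a \<le> s" "t \<le> b" for s t \<phi>
  proof -
    have "continuous_on {a..b} (\<lambda>\<tau>. (\<lambda>(t, x). h t x) (\<tau>, \<phi> \<tau>))"
      by (rule continuous_on_compose2[OF cont]) (auto intro!: continuous_intros that)
    then show ?thesis using that by (auto elim: continuous_on_subset)
  qed
  define \<Phi> where "\<Phi> \<phi> t = x0 + integral {a..p t} (\<lambda>\<tau>. h \<tau> (apply_bcontfun \<phi> \<tau>))"
    for \<phi> :: "real \<Rightarrow>\<^sub>C 'x" and t
  have bc: "\<Phi> \<phi> \<in> bcontfun" for \<phi>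
  proof -
    have int: "(\<lambda>\<tau>. h \<tau> (apply_bcontfun \<phi> \<tau>)) integrable_on {a..b}"
      by (intro integrable_continuous_real cont') (auto intro!: continuous_intros)
    have I: "continuous_on {a..b} (\<lambda>t. integral {a..t} (\<lambda>\<tau>. h \<tau> (apply_bcontfun \<phi> \<tau>)))"
      by (rule indefinite_integral_continuous_1[OF int])
    have "continuous_on UNIV (\<Phi> \<phi>)"
      unfolding \<Phi>_def
      by (intro continuous_intros continuous_on_compose2[OF I p(1)]) (use p in auto)
    moreover have "bounded (range (\<Phi> \<phi>))"
    proof -
      have "continuous_on {a..b} (\<lambda>t. x0 + integral {a..t} (\<lambda>\<tau>. h \<tau> (apply_bcontfun \<phi> \<tau>)))"
        by (intro continuous_intros I)
      then have "bounded ((\<lambda>t. x0 + integral {a..t} (\<lambda>\<tau>. h \<tau> (apply_bcontfun \<phi> \<tau>))) ` {a..b})"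
        by (intro compact_imp_bounded compact_continuous_image) auto
      then show ?thesis
        by (rule bounded_subset) (use p in \<open>auto simp: \<Phi>_def\<close>)
    qed
    ultimately show ?thesis by (simp add: bcontfun_def)
  qed
  have app: "apply_bcontfun (Bcontfun (\<Phi> \<phi>)) = \<Phi> \<phi>" for \<phi>
    using Bcontfun_inverse[OF bc] .
  have contract: "dist (Bcontfun (\<Phi> \<phi>)) (Bcontfun (\<Phi> \<psi>)) \<le> (L * (b - a)) * dist \<phi> \<psi>" for \<phi> \<psi>
  proof (rule dist_bound)
    fix t
    let ?d = "\<lambda>\<tau>. h \<tau> (apply_bcontfun \<phi> \<tau>) - h \<tau> (apply_bcontfun \<psi> \<tau>)"
    have int: "(\<lambda>\<tau>. h \<tau> (apply_bcontfun \<xi> \<tau>)) integrable_on {a..p t}" for \<xi>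
      by (intro integrable_continuous_real cont') (use p in \<open>auto intro!: continuous_intros\<close>)
    have "norm (integral {a..p t} ?d) \<le> L * dist \<phi> \<psi> * measure lborel (cbox a (p t))"
    proof (rule has_integral_bound)
      show "0 \<le> L * dist \<phi> \<psi>" using \<open>0 \<le> L\<close> by simp
      show "(?d has_integral integral {a..p t} ?d) (cbox a (p t))"
        using integrable_integral[OF integrable_diff[OF int int]] by simp
      fix \<tau> assume "\<tau> \<in> cbox a (p t)"
      then have "\<tau> \<in> {a..b}" using p(2)[of t] by auto
      then have "norm (?d \<tau>) \<le> L * dist (apply_bcontfun \<phi> \<tau>) (apply_bcontfun \<psi> \<tau>)"
        using lip by (simp add: dist_norm)
      also have "\<dots> \<le> L * dist \<phi> \<psi>"
        by (intro mult_left_mono dist_bounded \<open>0 \<le> L\<close>)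
      finally show "norm (?d \<tau>) \<le> L * dist \<phi> \<psi>" .
    qed
    also have "\<dots> \<le> L * dist \<phi> \<psi> * (b - a)"
      using p(2)[of t] \<open>0 \<le> L\<close> by (intro mult_left_mono) auto
    finally show "dist (apply_bcontfun (Bcontfun (\<Phi> \<phi>)) t) (apply_bcontfun (Bcontfun (\<Phi> \<psi>)) t)
        \<le> (L * (b - a)) * dist \<phi> \<psi>"
      unfolding app \<Phi>_def by (simp add: dist_norm integral_diff[OF int int, symmetric] mult_ac)
  qed
  then obtain \<phi> where \<phi>: "Bcontfun (\<Phi> \<phi>) = \<phi>"
    using banach_fix_type[of "L * (b - a)" "\<lambda>\<phi>. Bcontfun (\<Phi> \<phi>)"] assms by auto
  define x where "x = apply_bcontfun \<phi>"
  have cx: "continuous_on {a..b} x" unfolding x_def by (intro continuous_on_apply_bcontfun)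
  have x: "x t = x0 + integral {a..t} (\<lambda>\<tau>. h \<tau> (x \<tau>))" if "t \<in> {a..b}" for t
    using app[of \<phi>] p(3)[OF that] unfolding \<phi> x_def by (metis \<Phi>_def)
  show thesis
  proof
    show "x a = x0" using x[of a] \<open>a \<le> b\<close> by simp
    fix s t assume st: "a \<le> s" "s \<le> t" "t \<le> b"
    have "integral {a..s} (\<lambda>\<tau>. h \<tau> (x \<tau>)) + integral {s..t} (\<lambda>\<tau>. h \<tau> (x \<tau>))
        = integral {a..t} (\<lambda>\<tau>. h \<tau> (x \<tau>))"
      using st by (intro Henstock_Kurzweil_Integration.integral_combine integrable_continuous_real cont' cx) auto
    then have *: "x t - x s = integral {s..t} (\<lambda>\<tau>. h \<tau> (x \<tau>))"
      using x[of s] x[of t] st by (simp add: algebra_simps)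
    then show "((\<lambda>\<tau>. h \<tau> (x \<tau>)) has_integral (x t - x s)) {s..t}"
      unfolding * using st by (intro integrable_integral integrable_continuous_real cont' cx) auto
  qed
qed

section \<open>Attainable points\<close>

text \<open>The motion sets of the hypotheses are closures in the uniform metric, but the guide only uses
where a motion is at one later time. That point lies in the closure, in the state space, of the end points of
solutions (\<open>uniform_closure_attainable\<close>), and a bound that is closed in the end point passes from
solutions to this closure (\<open>attainable_property\<close>).\<close>

definition attainable ::
  "(real \<Rightarrow> 'x::euclidean_space \<Rightarrow> 'p \<Rightarrow> 'x) \<Rightarrow> (real \<Rightarrow> 'x \<Rightarrow> 'q \<Rightarrow> 'x)
    \<Rightarrow> 'p set \<Rightarrow> 'q set \<Rightarrow> real \<Rightarrow> 'x \<Rightarrow> real \<Rightarrow> 'x set" where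
  "attainable f g A B s \<eta> t = closure {y t | y u v. y s = \<eta> \<and>
     (\<forall>\<tau>\<in>{s..t}. u \<tau> \<in> A \<and> v \<tau> \<in> B) \<and> solves_on f g u v s t y}"

lemma attainable_commute: "attainable f g A B = attainable g f B A"
proof (intro ext)
  fix s \<eta> t
  have "{y t | y u v. y s = \<eta> \<and> (\<forall>\<tau>\<in>{s..t}. u \<tau> \<in> A \<and> v \<tau> \<in> B) \<and> solves_on f g u v s t y}
      = {y t | y v u. y s = \<eta> \<and> (\<forall>\<tau>\<in>{s..t}. v \<tau> \<in> B \<and> u \<tau> \<in> A) \<and> solves_on g f v u s t y}"
    unfolding solves_on_commute[of f g] by blast
  then show "attainable f g A B s \<eta> t = attainable g f B A s \<eta> t"
    unfolding attainable_def by simp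
qed

lemma attainable_property:
  assumes "\<eta>' \<in> attainable f g A B s \<eta> t" and "closed {p. \<Psi> p}"
    and "\<And>y u v. y s = \<eta> \<Longrightarrow> (\<And>\<tau>. \<tau> \<in> {s..t} \<Longrightarrow> u \<tau> \<in> A \<and> v \<tau> \<in> B)
      \<Longrightarrow> solves_on f g u v s t y \<Longrightarrow> \<Psi> (y t)"
  shows "\<Psi> \<eta>'"
proof -
  have "attainable f g A B s \<eta> t \<subseteq> {p. \<Psi> p}"
    unfolding attainable_def
    by (rule closure_minimal[OF _ assms(2)]) (use assms(3) in blast)
  then show ?thesis using assms(1) by blast
qed

lemma uniform_closure_attainable:
  assumes "y \<in> uniform_closure T X" and "t \<in> {0..T}"
    and "\<And>x. x \<in> X \<Longrightarrow> \<exists>u v. x s = \<eta> \<and> (\<forall>\<tau>\<in>{s..t}. u \<tau> \<in> A \<and> v \<tau> \<in> B) \<and> solves_on f g u v s t x"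
  shows "y t \<in> attainable f g A B s \<eta> t"
  unfolding attainable_def closure_approachable
proof (intro allI impI)
  fix e :: real assume "0 < e"
  let ?m = "cfunspace (top_of_set {0..T}) euclidean_metric :: (real \<Rightarrow> 'a) metric"
  interpret M: Metric_space "mspace ?m" "mdist ?m" by (rule Metric_space_mspace_mdist)
  have "y \<in> M.mtopology closure_of X"
    using assms(1) by (simp add: mtopology_of_def)
  then obtain x where x: "x \<in> X" "x \<in> M.mball y e"
    unfolding M.metric_closure_of using \<open>0 < e\<close> by blast
  have "mdist euclidean_metric (y t) (x t) < e"
  proof (rule cfunspace_mdist_lt[of "top_of_set {0..T}" y euclidean_metric x e t])
    show "compactin (top_of_set {0..T}) (topspace (top_of_set {0..T}))"
      by (simp add: compactin_subtopology)
  qed (use x assms(2) in \<open>auto simp del: mspace_cfunspace\<close>)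
  then have "dist (x t) (y t) < e" by (simp add: dist_commute)
  then show "\<exists>z\<in>{y t | y u v. y s = \<eta> \<and> (\<forall>\<tau>\<in>{s..t}. u \<tau> \<in> A \<and> v \<tau> \<in> B) \<and> solves_on f g u v s t y}.
      dist z (y t) < e"
    using assms(3)[OF x(1)] by blast
qed

lemma controls_mem: "u \<in> controls T P \<Longrightarrow> t \<in> {0..T} \<Longrightarrow> u t \<in> P"
  unfolding controls_def by (drule measurable_space[of _ _ _ t]) (auto simp: space_restrict_space)

lemma Sol_subset_attainable:
  assumes "y \<in> Sol T f g P Q s x" "0 \<le> s" "s \<le> t" "t \<le> T"
  shows "y t \<in> attainable f g P Q s x t"
  using assms(1) unfolding Sol_def
proof (rule uniform_closure_attainable)
  show "t \<in> {0..T}" using assms by simp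
  fix z assume "z \<in> (\<Union>u\<in>controls T P. \<Union>v\<in>controls T Q. trajectories T f g s x u v)"
  then obtain u v where "u \<in> controls T P" "v \<in> controls T Q" "z \<in> trajectories T f g s x u v"
    by blast
  then show "\<exists>u v. z s = x \<and> (\<forall>\<tau>\<in>{s..t}. u \<tau> \<in> P \<and> v \<tau> \<in> Q) \<and> solves_on f g u v s t z"
    using assms unfolding trajectories_def
    by (intro exI[of _ u] exI[of _ v]) (auto intro: controls_mem solves_on_subinterval)
qed

lemma Sol2_subset_attainable:
  assumes "y \<in> Sol2 T f g Q s x u" "0 \<le> s" "s \<le> t" "t \<le> T"
  shows "y t \<in> attainable f g {u} Q s x t"
  using assms(1) unfolding Sol2_def
proof (rule uniform_closure_attainable)
  show "t \<in> {0..T}" using assms by simp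
  fix z assume "z \<in> (\<Union>v\<in>controls T Q. trajectories T f g s x (\<lambda>_. u) v)"
  then obtain v where "v \<in> controls T Q" "z \<in> trajectories T f g s x (\<lambda>_. u) v"
    by blast
  then show "\<exists>u' v. z s = x \<and> (\<forall>\<tau>\<in>{s..t}. u' \<tau> \<in> {u} \<and> v \<tau> \<in> Q) \<and> solves_on f g u' v s t z"
    using assms unfolding trajectories_def
    by (intro exI[of _ "\<lambda>_. u"] exI[of _ v]) (auto intro: controls_mem solves_on_subinterval)
qed

lemma Sol1_eq_Sol2: "Sol1 T f g P t x v = Sol2 T g f P t x v"
  unfolding Sol1_def Sol2_def trajectories_def solves_on_commute[of f g] ..

section \<open>A priori bounds\<close>

text \<open>A solution that starts in the ball of radius \<open>R\<close> satisfies \<open>1 + norm x \<le> (1 + R) * exp (2 * K * T)\<close>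
up to time \<open>T\<close>, and each of the two parts of the dynamics contributes at most \<open>K\<close> times this
number to the velocity.\<close>

abbreviation speed :: "real \<Rightarrow> real \<Rightarrow> real \<Rightarrow> real" where
  "speed T K R \<equiv> 2 * K * (1 + R) * exp (2 * K * T)"

text \<open>One constant \<open>K\<close> serves as Lipschitz and as growth constant of both parts of the dynamics, so that
all estimates are invariant under exchanging the players.\<close>

locale controlled_system =
  fixes T K :: real
    and P :: "'p::metric_space set" and Q :: "'q::metric_space set"
    and f :: "real \<Rightarrow> 'x::euclidean_space \<Rightarrow> 'p \<Rightarrow> 'x"
    and g :: "real \<Rightarrow> 'x \<Rightarrow> 'q \<Rightarrow> 'x"
  assumes T_nonneg: "0 \<le> T" and K_nonneg: "0 \<le> K"
    and compact_P: "compact P" and P_nonempty: "P \<noteq> {}"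
    and compact_Q: "compact Q" and Q_nonempty: "Q \<noteq> {}"
    and continuous_f: "continuous_on ({0..T} \<times> UNIV \<times> P) (\<lambda>(t, x, u). f t x u)"
    and continuous_g: "continuous_on ({0..T} \<times> UNIV \<times> Q) (\<lambda>(t, x, v). g t x v)"
    and lipschitz_f: "\<lbrakk>t \<in> {0..T}; u \<in> P\<rbrakk> \<Longrightarrow> norm (f t x u - f t y u) \<le> K * norm (x - y)"
    and lipschitz_g: "\<lbrakk>t \<in> {0..T}; v \<in> Q\<rbrakk> \<Longrightarrow> norm (g t x v - g t y v) \<le> K * norm (x - y)"
    and growth_f: "\<lbrakk>t \<in> {0..T}; u \<in> P\<rbrakk> \<Longrightarrow> norm (f t x u) \<le> K * (1 + norm x)"
    and growth_g: "\<lbrakk>t \<in> {0..T}; v \<in> Q\<rbrakk> \<Longrightarrow> norm (g t x v) \<le> K * (1 + norm x)"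
begin

lemma swapped: "controlled_system T K Q P g f"
  by unfold_locales
    (use T_nonneg K_nonneg compact_P P_nonempty compact_Q Q_nonempty continuous_f continuous_g
      lipschitz_f lipschitz_g growth_f growth_g in auto)

lemma solution_growth:
  assumes x: "solves_on f g u v a b x" and "0 \<le> a" "b \<le> T" "t \<in> {a..b}"
    and uv: "\<And>\<tau>. \<tau> \<in> {a..b} \<Longrightarrow> u \<tau> \<in> P \<and> v \<tau> \<in> Q"
  shows "1 + norm (x t) \<le> (1 + norm (x a)) * exp (2 * K * (t - a))"
proof -
  have cont: "continuous_on {a..b} x" by (rule solves_on_continuous[OF x])
  have "1 + norm (x s) \<le> (1 + norm (x a)) + 2 * K * integral {a..s} (\<lambda>\<tau>. 1 + norm (x \<tau>))"
    if s: "s \<in> {a..b}" for s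
  proof -
    have *: "((\<lambda>\<tau>. f \<tau> (x \<tau>) (u \<tau>) + g \<tau> (x \<tau>) (v \<tau>)) has_integral (x s - x a)) {a..s}"
      using x s unfolding solves_on_def by auto
    have "continuous_on {a..s} (\<lambda>\<tau>. 2 * K * (1 + norm (x \<tau>)))"
      using s by (auto intro!: continuous_intros continuous_on_subset[OF cont])
    then have "norm (integral {a..s} (\<lambda>\<tau>. f \<tau> (x \<tau>) (u \<tau>) + g \<tau> (x \<tau>) (v \<tau>)))
        \<le> integral {a..s} (\<lambda>\<tau>. 2 * K * (1 + norm (x \<tau>)))"
    proof (intro integral_norm_bound_integral has_integral_integrable[OF *] integrable_continuous_real)
      fix \<tau> assume "\<tau> \<in> {a..s}"
      then have "\<tau> \<in> {0..T}" "u \<tau> \<in> P" "v \<tau> \<in> Q"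
        using s assms by auto
      then show "norm (f \<tau> (x \<tau>) (u \<tau>) + g \<tau> (x \<tau>) (v \<tau>)) \<le> 2 * K * (1 + norm (x \<tau>))"
        using growth_f[of \<tau> "u \<tau>" "x \<tau>"] growth_g[of \<tau> "v \<tau>" "x \<tau>"]
        by (intro order_trans[OF norm_triangle_ineq]) simp
    qed
    then have "norm (x s - x a) \<le> 2 * K * integral {a..s} (\<lambda>\<tau>. 1 + norm (x \<tau>))"
      unfolding integral_unique[OF *] by simp
    then show ?thesis using norm_triangle_ineq2[of "x s" "x a"] by linarith
  qed
  then show ?thesis
    using K_nonneg \<open>t \<in> {a..b}\<close>
    by (intro gronwall[of a b "\<lambda>t. 1 + norm (x t)"]) (auto intro!: continuous_intros cont)
qed

lemma solution_norm_le:
  assumes "solves_on f g u v a b x" "0 \<le> a" "b \<le> T" "t \<in> {a..b}"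
    and "\<And>\<tau>. \<tau> \<in> {a..b} \<Longrightarrow> u \<tau> \<in> P \<and> v \<tau> \<in> Q" and "norm (x a) \<le> R"
  shows "1 + norm (x t) \<le> (1 + R) * exp (2 * K * T)"
proof -
  have "1 + norm (x t) \<le> (1 + norm (x a)) * exp (2 * K * (t - a))"
    by (rule solution_growth[OF assms(1-5)])
  also have "\<dots> \<le> (1 + R) * exp (2 * K * T)"
    using assms K_nonneg order_trans[OF norm_ge_zero \<open>norm (x a) \<le> R\<close>]
    by (intro mult_mono) (auto intro!: mult_left_mono)
  finally show ?thesis .
qed

lemma solution_speed:
  assumes x: "solves_on f g u v a b x" and "0 \<le> a" "b \<le> T" "t \<in> {a..b}"
    and uv: "\<And>\<tau>. \<tau> \<in> {a..b} \<Longrightarrow> u \<tau> \<in> P \<and> v \<tau> \<in> Q" and "norm (x a) \<le> R"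
  shows "norm (x t - x a) \<le> speed T K R * (t - a)"
proof -
  have "norm (x t - x a) \<le> speed T K R * measure lborel (cbox a t)"
  proof (rule has_integral_bound)
    show "((\<lambda>\<tau>. f \<tau> (x \<tau>) (u \<tau>) + g \<tau> (x \<tau>) (v \<tau>)) has_integral (x t - x a)) (cbox a t)"
      using x \<open>t \<in> {a..b}\<close> unfolding solves_on_def by auto
    show "0 \<le> speed T K R"
      using K_nonneg order_trans[OF norm_ge_zero \<open>norm (x a) \<le> R\<close>] by simp
    fix \<tau> assume "\<tau> \<in> cbox a t"
    then have \<tau>: "\<tau> \<in> {a..b}" "\<tau> \<in> {0..T}" "u \<tau> \<in> P" "v \<tau> \<in> Q" using assms by auto
    have "norm (f \<tau> (x \<tau>) (u \<tau>) + g \<tau> (x \<tau>) (v \<tau>)) \<le> 2 * K * (1 + norm (x \<tau>))"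
      using growth_f[of \<tau> "u \<tau>" "x \<tau>"] growth_g[of \<tau> "v \<tau>" "x \<tau>"] \<tau>
      by (intro order_trans[OF norm_triangle_ineq]) simp
    also have "\<dots> \<le> 2 * K * ((1 + R) * exp (2 * K * T))"
      using assms \<tau> K_nonneg by (intro mult_left_mono solution_norm_le[OF x]) auto
    finally show "norm (f \<tau> (x \<tau>) (u \<tau>) + g \<tau> (x \<tau>) (v \<tau>)) \<le> speed T K R" by (simp only: mult.assoc)
  qed
  then show ?thesis using \<open>t \<in> {a..b}\<close> by simp
qed

lemma attainable_growth:
  assumes "\<eta>' \<in> attainable f g A B s \<eta> t" "A \<subseteq> P" "B \<subseteq> Q" "0 \<le> s" "s \<le> t" "t \<le> T"
  shows "1 + norm \<eta>' \<le> (1 + norm \<eta>) * exp (2 * K * (t - s))"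
  using assms(1)
proof (rule attainable_property)
  show "closed {p. 1 + norm p \<le> (1 + norm \<eta>) * exp (2 * K * (t - s))}"
    by (intro closed_Collect_le continuous_intros)
  show "1 + norm (y t) \<le> (1 + norm \<eta>) * exp (2 * K * (t - s))"
    if "y s = \<eta>" "\<And>\<tau>. \<tau> \<in> {s..t} \<Longrightarrow> u \<tau> \<in> A \<and> v \<tau> \<in> B" "solves_on f g u v s t y" for y u v
    using solution_growth[OF that(3), of t] that(1,2) assms by force
qed

lemma attainable_speed:
  assumes "\<eta>' \<in> attainable f g A B s \<eta> t" "A \<subseteq> P" "B \<subseteq> Q" "0 \<le> s" "s \<le> t" "t \<le> T" "norm \<eta> \<le> R"
  shows "norm (\<eta>' - \<eta>) \<le> speed T K R * (t - s)"
  using assms(1)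
proof (rule attainable_property)
  show "closed {p. norm (p - \<eta>) \<le> speed T K R * (t - s)}"
    by (intro closed_Collect_le continuous_intros)
  show "norm (y t - \<eta>) \<le> speed T K R * (t - s)"
    if "y s = \<eta>" "\<And>\<tau>. \<tau> \<in> {s..t} \<Longrightarrow> u \<tau> \<in> A \<and> v \<tau> \<in> B" "solves_on f g u v s t y" for y u v
    using solution_speed[OF that(3), of t R] that(1,2) assms by force
qed

text \<open>Short intervals suffice: joint motions only have to be produced on partitions that may be refined at
will.\<close>

lemma constant_control_solution:
  assumes "u \<in> P" "v \<in> Q" "0 \<le> a" "a \<le> b" "b \<le> T" "2 * K * (b - a) < 1"
  obtains x where "x a = x0" "solves_on f g (\<lambda>_. u) (\<lambda>_. v) a b x"
proof (rule picard_local_solution[of a b "\<lambda>t x. f t x u + g t x v" "2 * K" x0])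
  have "continuous_on ({a..b} \<times> UNIV) (\<lambda>z. (\<lambda>(t, x, u). f t x u) (fst z, snd z, u))"
    by (rule continuous_on_compose2[OF continuous_f]) (use assms in \<open>auto intro!: continuous_intros\<close>)
  moreover have "continuous_on ({a..b} \<times> UNIV) (\<lambda>z. (\<lambda>(t, x, v). g t x v) (fst z, snd z, v))"
    by (rule continuous_on_compose2[OF continuous_g]) (use assms in \<open>auto intro!: continuous_intros\<close>)
  ultimately show "continuous_on ({a..b} \<times> UNIV) (\<lambda>(t, x). f t x u + g t x v)"
    by (auto simp: case_prod_beta intro!: continuous_on_add)
  fix t x y assume "t \<in> {a..b}"
  then have t: "t \<in> {0..T}" using assms by auto
  have "f t x u + g t x v - (f t y u + g t y v) = (f t x u - f t y u) + (g t x v - g t y v)"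
    by simp
  then have "norm (f t x u + g t x v - (f t y u + g t y v))
      \<le> norm (f t x u - f t y u) + norm (g t x v - g t y v)"
    using norm_triangle_ineq by metis
  then show "norm (f t x u + g t x v - (f t y u + g t y v)) \<le> 2 * K * norm (x - y)"
    using lipschitz_f[OF t \<open>u \<in> P\<close>, of x y] lipschitz_g[OF t \<open>v \<in> Q\<close>, of x y] by linarith
qed (use assms K_nonneg that in \<open>auto simp: solves_on_def\<close>)

end

section \<open>Extremal shift\<close>

text \<open>The velocities \<open>p\<close> and \<open>q\<close> at the current time are frozen to \<open>p0\<close> and \<open>q0\<close> at the last node; \<open>q1\<close> has
the state of \<open>p0\<close> and the control of \<open>q0\<close>. Then \<open>p - q\<close> splits into freezing errors, a Lipschitz
difference in the state, and \<open>p0 - q1\<close>, a difference in the control only, which the extremal choice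
renders harmless in the direction \<open>z\<close>.\<close>

lemma extremal_drift:
  fixes z p q :: "'x::real_inner"
  assumes "norm (p - p0) \<le> \<omega>" "norm (q - q0) \<le> \<omega>" "norm (q1 - q0) \<le> K * norm z"
    and "z \<bullet> (p0 - q1) \<le> 0"
  shows "z \<bullet> (p - q) \<le> 2 * \<omega> * norm z + K * (norm z)\<^sup>2"
proof -
  have "z \<bullet> (p - q) = z \<bullet> (p - p0) + z \<bullet> (p0 - q1) + z \<bullet> (q1 - q0) - z \<bullet> (q - q0)"
    by (simp add: inner_diff_right)
  moreover have "z \<bullet> (p - p0) \<le> norm z * \<omega>"
    by (rule order_trans[OF norm_cauchy_schwarz]) (intro mult_left_mono assms norm_ge_zero)
  moreover have "- (z \<bullet> (q - q0)) \<le> norm z * \<omega>"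
    using norm_cauchy_schwarz[of z "- (q - q0)"] mult_left_mono[OF assms(2) norm_ge_zero[of z]]
    by (simp only: inner_minus_right norm_minus_cancel)
  moreover have "z \<bullet> (q1 - q0) \<le> norm z * (K * norm z)"
    by (rule order_trans[OF norm_cauchy_schwarz]) (intro mult_left_mono assms norm_ge_zero)
  ultimately show ?thesis
    using assms(4) by (simp add: power2_eq_square algebra_simps)
qed

text \<open>The sets \<open>A\<close> and \<open>B\<close> contain the controls with which the point \<open>\<eta>'\<close> is reached. Asking that the
controls of \<open>x\<close> be extremal against \<open>A\<close> and \<open>B\<close> covers joint play (\<open>A = P\<close>, \<open>B = Q\<close>, the controls of
\<open>x\<close> are minimizers) as well as punishment (\<open>A = P\<close>, \<open>B\<close> consists of a maximizer over \<open>Q\<close>, and the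
control \<open>v\<close> is arbitrary).\<close>

definition shift_bound ::
  "real \<Rightarrow> real \<Rightarrow> 'p set \<Rightarrow> 'q set \<Rightarrow> (real \<Rightarrow> 'x::euclidean_space \<Rightarrow> 'p \<Rightarrow> 'x)
    \<Rightarrow> (real \<Rightarrow> 'x \<Rightarrow> 'q \<Rightarrow> 'x) \<Rightarrow> real \<Rightarrow> real \<Rightarrow> real \<Rightarrow> bool" where
  "shift_bound T K P Q f g R h \<epsilon> \<longleftrightarrow>
     (\<forall>s x u v A B \<eta> \<eta>'. 0 \<le> s \<longrightarrow> s + h \<le> T \<longrightarrow> norm (x s) \<le> R \<longrightarrow> norm \<eta> \<le> R \<longrightarrow>
        A \<subseteq> P \<longrightarrow> B \<subseteq> Q \<longrightarrow> solves_on f g u v s (s + h) x \<longrightarrow>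
        \<eta>' \<in> attainable f g A B s \<eta> (s + h) \<longrightarrow>
        (\<forall>\<tau>\<in>{s..s + h}. u \<tau> \<in> P \<and> (\<forall>a\<in>A. (x s - \<eta>) \<bullet> (f s (x s) (u \<tau>) - f s (x s) a) \<le> 0)) \<longrightarrow>
        (\<forall>\<tau>\<in>{s..s + h}. v \<tau> \<in> Q \<and> (\<forall>b\<in>B. (x s - \<eta>) \<bullet> (g s (x s) (v \<tau>) - g s (x s) b) \<le> 0)) \<longrightarrow>
        (norm (x (s + h) - \<eta>'))\<^sup>2 \<le> (1 + 4 * K * h) * (norm (x s - \<eta>))\<^sup>2 + h * \<epsilon>)"

lemma shift_bound_commute:
  assumes "shift_bound T K P Q f g R h \<epsilon>"
  shows "shift_bound T K Q P g f R h \<epsilon>"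
  unfolding shift_bound_def
proof (intro allI impI)
  fix s x u v A B \<eta> \<eta>'
  assume *: "0 \<le> s" "s + h \<le> T" "norm (x s) \<le> R" "norm \<eta> \<le> R" "A \<subseteq> Q" "B \<subseteq> P"
    "solves_on g f u v s (s + h) x" "\<eta>' \<in> attainable g f A B s \<eta> (s + h)"
    "\<forall>\<tau>\<in>{s..s + h}. u \<tau> \<in> Q \<and> (\<forall>a\<in>A. (x s - \<eta>) \<bullet> (g s (x s) (u \<tau>) - g s (x s) a) \<le> 0)"
    "\<forall>\<tau>\<in>{s..s + h}. v \<tau> \<in> P \<and> (\<forall>b\<in>B. (x s - \<eta>) \<bullet> (f s (x s) (v \<tau>) - f s (x s) b) \<le> 0)"
  from *(7,8) have "solves_on f g v u s (s + h) x" "\<eta>' \<in> attainable f g B A s \<eta> (s + h)"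
    by (simp_all only: solves_on_commute[of g f] attainable_commute[of g f])
  with * show "(norm (x (s + h) - \<eta>'))\<^sup>2 \<le> (1 + 4 * K * h) * (norm (x s - \<eta>))\<^sup>2 + h * \<epsilon>"
    using assms unfolding shift_bound_def by blast
qed

lemma uniform_modulus_in_time_state:
  fixes F :: "real \<Rightarrow> 'x::euclidean_space \<Rightarrow> 'p::metric_space \<Rightarrow> 'x"
  assumes "compact P" "continuous_on ({0..T} \<times> UNIV \<times> P) (\<lambda>(t, x, u). F t x u)" "0 < \<omega>"
  obtains d where "0 < d"
    and "\<And>s t x y u. \<lbrakk>s \<in> {0..T}; t \<in> {0..T}; norm x \<le> r; norm y \<le> r; u \<in> P; \<bar>t - s\<bar> < d;
      norm (y - x) < d\<rbrakk> \<Longrightarrow> norm (F t y u - F s x u) \<le> \<omega>"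
proof -
  let ?C = "{0..T} \<times> cball 0 r \<times> P"
  have "uniformly_continuous_on ?C (\<lambda>(t, x, u). F t x u)"
    by (intro compact_uniformly_continuous compact_Times assms(1) continuous_on_subset[OF assms(2)])
       auto
  then obtain d where d: "0 < d" "\<And>p q. \<lbrakk>p \<in> ?C; q \<in> ?C; dist q p < d\<rbrakk>
      \<Longrightarrow> dist ((\<lambda>(t, x, u). F t x u) q) ((\<lambda>(t, x, u). F t x u) p) < \<omega>"
    unfolding uniformly_continuous_on_def using \<open>0 < \<omega>\<close> by meson
  show thesis
  proof
    show "0 < d / 2" using d by simp
    fix s t u and x y :: 'x
    assume *: "s \<in> {0..T}" "t \<in> {0..T}" "norm x \<le> r" "norm y \<le> r" "u \<in> P" "\<bar>t - s\<bar> < d / 2"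
      "norm (y - x) < d / 2"
    have "dist (t, y, u) (s, x, u) = sqrt (\<bar>t - s\<bar>\<^sup>2 + (norm (y - x))\<^sup>2)"
      by (simp add: dist_Pair_Pair dist_norm)
    also have "\<dots> \<le> \<bar>t - s\<bar> + norm (y - x)"
      by (rule sqrt_sum_squares_le_sum) auto
    finally have "dist (t, y, u) (s, x, u) < d" using * by linarith
    then show "norm (F t y u - F s x u) \<le> \<omega>"
      using d(2)[of "(s, x, u)" "(t, y, u)"] * by (auto simp: dist_norm)
  qed
qed

context controlled_system
begin

text \<open>With \<open>z = x s - \<eta>\<close>, the squared distance at time \<open>s + h\<close> is the sum of \<open>(norm z)\<^sup>2\<close>, of twice the
integral of the inner product of \<open>z\<close> with the velocity difference, and of a term of order \<open>h\<^sup>2\<close>. The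
integrand is estimated by \<open>extremal_drift\<close> for \<open>f\<close> and for \<open>g\<close>; the freezing errors are controlled by
uniform continuity on a compact set that contains all solutions starting in the ball of radius \<open>R\<close>.\<close>

lemma extremal_shift:
  assumes "0 < \<epsilon>" "0 \<le> R"
  obtains \<delta> where "0 < \<delta>" and "\<And>h. \<lbrakk>0 < h; h \<le> \<delta>\<rbrakk> \<Longrightarrow> shift_bound T K P Q f g R h \<epsilon>"
proof -
  define r where "r = (1 + R) * exp (2 * K * T)"
  define M where "M = speed T K R"
  have M: "0 \<le> M" using K_nonneg assms by (simp add: M_def)
  \<comment> \<open>Half of the error budget is for the freezing errors, the other half for the quadratic term.\<close>
  define \<omega> where "\<omega> = \<epsilon> / (32 * (R + 1))"
  have \<omega>: "0 < \<omega>" "16 * R * \<omega> \<le> \<epsilon> / 2"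
    using assms by (auto simp: \<omega>_def field_simps)
  obtain d1 where d1: "0 < d1" "\<And>s t x y u. \<lbrakk>s \<in> {0..T}; t \<in> {0..T}; norm x \<le> r; norm y \<le> r;
      u \<in> P; \<bar>t - s\<bar> < d1; norm (y - x) < d1\<rbrakk> \<Longrightarrow> norm (f t y u - f s x u) \<le> \<omega>"
    using uniform_modulus_in_time_state[OF compact_P continuous_f \<omega>(1), of r] by metis
  obtain d2 where d2: "0 < d2" "\<And>s t x y v. \<lbrakk>s \<in> {0..T}; t \<in> {0..T}; norm x \<le> r; norm y \<le> r;
      v \<in> Q; \<bar>t - s\<bar> < d2; norm (y - x) < d2\<rbrakk> \<Longrightarrow> norm (g t y v - g s x v) \<le> \<omega>"
    using uniform_modulus_in_time_state[OF compact_Q continuous_g \<omega>(1), of r] by metis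
  define d where "d = min d1 d2"
  define \<delta> where "\<delta> = min (d / (2 * (1 + M))) (\<epsilon> / (8 * (1 + M\<^sup>2)))"
  have d: "0 < d" using d1 d2 by (simp add: d_def)
  show thesis
  proof
    show "0 < \<delta>" using d M \<open>0 < \<epsilon>\<close> by (auto simp: \<delta>_def add_pos_nonneg)
    fix h assume h: "0 < h" "h \<le> \<delta>"
    have "h \<le> d / (2 * (1 + M))" "h \<le> \<epsilon> / (8 * (1 + M\<^sup>2))"
      using h by (auto simp: \<delta>_def)
    then have "2 * (h * (1 + M)) \<le> d" "8 * (h * (1 + M\<^sup>2)) \<le> \<epsilon>"
      using M by (simp_all add: field_simps add_pos_nonneg)
    moreover have "0 \<le> h * M" "0 \<le> h * M\<^sup>2" using h M by auto
    ultimately have hd: "h < d" "M * h < d" and he: "4 * M\<^sup>2 * h \<le> \<epsilon> / 2"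
      using h \<open>0 < d\<close> by (auto simp: algebra_simps)
    show "shift_bound T K P Q f g R h \<epsilon>"
      unfolding shift_bound_def
    proof (intro allI impI)
      fix s x u v A B \<eta> \<eta>'
      assume s: "0 \<le> s" "s + h \<le> T" and R: "norm (x s) \<le> R" "norm \<eta> \<le> R"
        and AB: "A \<subseteq> P" "B \<subseteq> Q" and x: "solves_on f g u v s (s + h) x"
        and \<eta>': "\<eta>' \<in> attainable f g A B s \<eta> (s + h)"
        and u: "\<forall>\<tau>\<in>{s..s + h}. u \<tau> \<in> P \<and> (\<forall>a\<in>A. (x s - \<eta>) \<bullet> (f s (x s) (u \<tau>) - f s (x s) a) \<le> 0)"
        and v: "\<forall>\<tau>\<in>{s..s + h}. v \<tau> \<in> Q \<and> (\<forall>b\<in>B. (x s - \<eta>) \<bullet> (g s (x s) (v \<tau>) - g s (x s) b) \<le> 0)"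
      let ?z = "x s - \<eta>"
      have "norm ?z \<le> 2 * R"
        using R norm_triangle_ineq4[of "x s" \<eta>] by linarith
      then have z: "8 * \<omega> * norm ?z * h \<le> h * (\<epsilon> / 2)"
      proof -
        have "8 * \<omega> * norm ?z \<le> 8 * \<omega> * (2 * R)"
          using \<open>norm ?z \<le> 2 * R\<close> \<omega> by (intro mult_left_mono) auto
        also have "\<dots> \<le> \<epsilon> / 2" using \<omega>(2) by (simp add: mult_ac)
        finally show ?thesis using h by (simp add: mult.commute)
      qed
      have x_in: "norm (x \<tau>) \<le> r" "norm (x \<tau> - x s) < d" if "\<tau> \<in> {s..s + h}" for \<tau>
      proof -
        have "1 + norm (x \<tau>) \<le> r"
          unfolding r_def using s that u v by (intro solution_norm_le[OF x] R) auto
        then show "norm (x \<tau>) \<le> r" by simp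
        have "norm (x \<tau> - x s) \<le> M * (\<tau> - s)"
          unfolding M_def using s that u v by (intro solution_speed[OF x] R) auto
        also have "\<dots> \<le> M * h" using that M by (intro mult_left_mono) auto
        finally show "norm (x \<tau> - x s) < d" using hd by simp
      qed
      show "(norm (x (s + h) - \<eta>'))\<^sup>2 \<le> (1 + 4 * K * h) * (norm (x s - \<eta>))\<^sup>2 + h * \<epsilon>"
        using \<eta>'
      proof (rule attainable_property)
        show "closed {p. (norm (x (s + h) - p))\<^sup>2 \<le> (1 + 4 * K * h) * (norm (x s - \<eta>))\<^sup>2 + h * \<epsilon>}"
          by (intro closed_Collect_le continuous_intros)
        fix y u' v'
        assume y0: "y s = \<eta>" and uv': "\<And>\<tau>. \<tau> \<in> {s..s + h} \<Longrightarrow> u' \<tau> \<in> A \<and> v' \<tau> \<in> B"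
          and y: "solves_on f g u' v' s (s + h) y"
        have uv'_in: "u' \<tau> \<in> P \<and> v' \<tau> \<in> Q" if "\<tau> \<in> {s..s + h}" for \<tau>
          using uv'[OF that] AB by auto
        have y_in: "norm (y \<tau>) \<le> r" "norm (y \<tau> - \<eta>) < d" if "\<tau> \<in> {s..s + h}" for \<tau>
        proof -
          have "1 + norm (y \<tau>) \<le> r"
            unfolding r_def using s that uv'_in R y0 by (intro solution_norm_le[OF y]) auto
          then show "norm (y \<tau>) \<le> r" by simp
          have "norm (y \<tau> - y s) \<le> M * (\<tau> - s)"
            unfolding M_def using s that uv'_in R y0 by (intro solution_speed[OF y]) auto
          also have "\<dots> \<le> M * h" using that M by (intro mult_left_mono) auto
          finally show "norm (y \<tau> - \<eta>) < d" using hd y0 by simp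
        qed
        let ?X = "\<lambda>\<tau>. f \<tau> (x \<tau>) (u \<tau>) + g \<tau> (x \<tau>) (v \<tau>)"
        let ?Y = "\<lambda>\<tau>. f \<tau> (y \<tau>) (u' \<tau>) + g \<tau> (y \<tau>) (v' \<tau>)"
        let ?D = "(x (s + h) - x s) - (y (s + h) - y s)"
        have int: "((\<lambda>\<tau>. ?z \<bullet> (?X \<tau> - ?Y \<tau>)) has_integral ?z \<bullet> ?D) {s..s + h}"
          using has_integral_linear[OF has_integral_diff bounded_linear_inner_right[of ?z],
              of ?X "x (s + h) - x s" "{s..s + h}" ?Y "y (s + h) - y s"] x y h
          unfolding solves_on_def o_def by auto
        have drift: "?z \<bullet> (?X \<tau> - ?Y \<tau>) \<le> 4 * \<omega> * norm ?z + 2 * K * (norm ?z)\<^sup>2"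
          if \<tau>: "\<tau> \<in> {s..s + h}" for \<tau>
        proof -
          have t: "s \<in> {0..T}" "\<tau> \<in> {0..T}" "\<bar>\<tau> - s\<bar> < d1" "\<bar>\<tau> - s\<bar> < d2"
            using \<tau> s h hd unfolding d_def by auto
          have mem: "u \<tau> \<in> P" "u' \<tau> \<in> P" "v \<tau> \<in> Q" "v' \<tau> \<in> Q"
            using u v uv'_in[OF \<tau>] \<tau> by auto
          have near: "norm (x \<tau> - x s) < d1" "norm (x \<tau> - x s) < d2"
            "norm (y \<tau> - \<eta>) < d1" "norm (y \<tau> - \<eta>) < d2"
            using x_in(2)[OF \<tau>] y_in(2)[OF \<tau>] unfolding d_def by auto
          have r: "norm (x s) \<le> r" "norm \<eta> \<le> r"
            using x_in(1)[of s] y_in(1)[of s] y0 h by auto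
          have 1: "?z \<bullet> (f \<tau> (x \<tau>) (u \<tau>) - f \<tau> (y \<tau>) (u' \<tau>)) \<le> 2 * \<omega> * norm ?z + K * (norm ?z)\<^sup>2"
            using u uv'[OF \<tau>] \<tau>
            by (intro extremal_drift[where ?p0.0 = "f s (x s) (u \<tau>)" and ?q0.0 = "f s \<eta> (u' \<tau>)"
                  and ?q1.0 = "f s (x s) (u' \<tau>)"] d1(2) lipschitz_f t mem near x_in y_in r) auto
          have 2: "?z \<bullet> (g \<tau> (x \<tau>) (v \<tau>) - g \<tau> (y \<tau>) (v' \<tau>)) \<le> 2 * \<omega> * norm ?z + K * (norm ?z)\<^sup>2"
            using v uv'[OF \<tau>] \<tau>
            by (intro extremal_drift[where ?p0.0 = "g s (x s) (v \<tau>)" and ?q0.0 = "g s \<eta> (v' \<tau>)"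
                  and ?q1.0 = "g s (x s) (v' \<tau>)"] d2(2) lipschitz_g t mem near x_in y_in r) auto
          have "?z \<bullet> (?X \<tau> - ?Y \<tau>) = ?z \<bullet> (f \<tau> (x \<tau>) (u \<tau>) - f \<tau> (y \<tau>) (u' \<tau>))
              + ?z \<bullet> (g \<tau> (x \<tau>) (v \<tau>) - g \<tau> (y \<tau>) (v' \<tau>))"
            by (simp add: inner_diff_right inner_add_right)
          with 1 2 show ?thesis by linarith
        qed
        have "?z \<bullet> ?D \<le> (4 * \<omega> * norm ?z + 2 * K * (norm ?z)\<^sup>2) * h"
          using has_integral_le[OF int has_integral_const_real[of "4 * \<omega> * norm ?z + 2 * K * (norm ?z)\<^sup>2" s "s + h"]] drift h
          by (auto simp: mult.commute)
        moreover have "norm ?D \<le> 2 * M * h"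
        proof -
          have "norm (x (s + h) - x s) \<le> M * (s + h - s)"
            unfolding M_def using s h u v by (intro solution_speed[OF x] R) auto
          moreover have "norm (y (s + h) - y s) \<le> M * (s + h - s)"
            unfolding M_def using s h uv'_in R y0 by (intro solution_speed[OF y]) auto
          ultimately show ?thesis
            using norm_triangle_ineq4[of "x (s + h) - x s" "y (s + h) - y s"] by simp
        qed
        then have "(norm ?D)\<^sup>2 \<le> h * (4 * M\<^sup>2 * h)"
          using power_mono[of "norm ?D" "2 * M * h" 2] by (simp add: power_mult_distrib power2_eq_square mult_ac)
        then have "(norm ?D)\<^sup>2 \<le> h * (\<epsilon> / 2)"
          using mult_left_mono[OF he, of h] h by linarith
        moreover have "x (s + h) - y (s + h) = ?z + ?D" using y0 by simp
        then have "(norm (x (s + h) - y (s + h)))\<^sup>2 = (norm ?z)\<^sup>2 + 2 * (?z \<bullet> ?D) + (norm ?D)\<^sup>2"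
          by (simp only: power2_norm_eq_inner inner_add_left inner_add_right inner_commute[of ?D ?z])
        ultimately show "(norm (x (s + h) - y (s + h)))\<^sup>2
            \<le> (1 + 4 * K * h) * (norm (x s - \<eta>))\<^sup>2 + h * \<epsilon>"
          using z by (simp add: algebra_simps)
      qed
    qed
  qed
qed

text \<open>The strategies need an error that depends on the step alone and not on a prescribed accuracy. It
is taken from the set of admissible errors for the step \<open>h\<close>, within \<open>h\<close> of the infimum,
since the infimum need not be admissible.\<close>

lemma error_rate_exists:
  assumes "0 \<le> R"
  obtains \<phi> where "\<And>\<epsilon>. 0 < \<epsilon> \<Longrightarrow>
    \<exists>\<delta>>0. \<forall>h. 0 < h \<longrightarrow> h \<le> \<delta> \<longrightarrow> \<phi> h \<le> \<epsilon> \<and> shift_bound T K P Q f g R h (\<phi> h)"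
proof -
  define E where "E h = {\<epsilon>. 0 < \<epsilon> \<and> shift_bound T K P Q f g R h \<epsilon>}" for h
  define \<phi> where "\<phi> h = (SOME \<epsilon>. \<epsilon> \<in> E h \<and> \<epsilon> < Inf (E h) + h)" for h
  show thesis
  proof
    fix \<epsilon> :: real assume "0 < \<epsilon>"
    then obtain \<delta> where \<delta>: "0 < \<delta>" "\<And>h. \<lbrakk>0 < h; h \<le> \<delta>\<rbrakk> \<Longrightarrow> shift_bound T K P Q f g R h (\<epsilon> / 2)"
      using extremal_shift[of "\<epsilon> / 2" R] assms by auto
    show "\<exists>\<delta>>0. \<forall>h. 0 < h \<longrightarrow> h \<le> \<delta> \<longrightarrow> \<phi> h \<le> \<epsilon> \<and> shift_bound T K P Q f g R h (\<phi> h)"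
    proof (intro exI[of _ "min \<delta> (\<epsilon> / 2)"] conjI allI impI)
      show "0 < min \<delta> (\<epsilon> / 2)" using \<delta> \<open>0 < \<epsilon>\<close> by simp
      fix h assume h: "0 < h" "h \<le> min \<delta> (\<epsilon> / 2)"
      have in_E: "\<epsilon> / 2 \<in> E h" using \<delta>(2)[of h] h \<open>0 < \<epsilon>\<close> by (simp add: E_def)
      have bdd: "bdd_below (E h)" by (intro bdd_belowI[of _ 0]) (auto simp: E_def)
      have "\<exists>\<epsilon>. \<epsilon> \<in> E h \<and> \<epsilon> < Inf (E h) + h"
        using cInf_lessD[of "E h" "Inf (E h) + h"] in_E h by auto
      then have *: "\<phi> h \<in> E h" "\<phi> h < Inf (E h) + h"
        unfolding \<phi>_def by (metis (mono_tags, lifting) someI_ex)+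
      show "\<phi> h \<le> \<epsilon>" using *(2) cInf_lower[OF in_E bdd] h by simp
      show "shift_bound T K P Q f g R h (\<phi> h)" using *(1) by (simp add: E_def)
    qed
  qed
qed

end

section \<open>Partitions\<close>

lemma partition_mono:
  assumes "is_partition a b r \<tau>" "i \<le> j" "j \<le> r"
  shows "\<tau> i \<le> \<tau> j"
  using assms(2,3)
proof (induction j rule: dec_induct)
  case (step j)
  then have "\<tau> j < \<tau> (Suc j)" using assms(1) by (simp add: is_partition_def)
  with step show ?case by simp
qed simp

lemma partition_bounds:
  assumes "is_partition a b r \<tau>" "k \<le> r"
  shows "a \<le> \<tau> k" "\<tau> k \<le> b"
  using partition_mono[OF assms(1), of 0 k] partition_mono[OF assms(1), of k r] assms
  by (auto simp: is_partition_def)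

lemma partition_step:
  assumes "is_partition a b r \<tau>" "mesh r \<tau> \<le> \<delta>" "k < r"
  shows "0 < \<tau> (Suc k) - \<tau> k" "\<tau> (Suc k) - \<tau> k \<le> \<delta>"
proof -
  show "0 < \<tau> (Suc k) - \<tau> k" using assms by (simp add: is_partition_def)
  have "\<tau> (Suc k) - \<tau> k \<le> mesh r \<tau>"
    unfolding mesh_def using assms(3) by (intro Max_ge) auto
  then show "\<tau> (Suc k) - \<tau> k \<le> \<delta>" using assms(2) by simp
qed

lemma fine_partition_exists:
  assumes "a \<le> b" "0 < \<delta>"
  obtains r \<tau> where "is_partition a b r \<tau>" "mesh r \<tau> \<le> \<delta>"
proof (cases "a = b")
  case True
  show thesis
    by (rule that[of 0 "\<lambda>_. a"]) (use True assms in \<open>auto simp: is_partition_def mesh_def\<close>)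
next
  case False
  with assms have ab: "a < b" by simp
  obtain n :: nat where n: "(b - a) / \<delta> < n" using reals_Archimedean2 by blast
  have "0 < (b - a) / \<delta>" using ab assms by simp
  with n have n0: "0 < real n" by linarith
  show thesis
  proof (rule that[of n "\<lambda>k. a + k * ((b - a) / n)"])
    show "is_partition a b n (\<lambda>k. a + k * ((b - a) / n))"
      using n0 ab by (auto simp: is_partition_def divide_simps algebra_simps)
    have "(b - a) / n \<le> \<delta>"
      using n n0 assms(2) by (simp add: divide_simps mult.commute)
    moreover have "a + real (Suc k) * ((b - a) / n) - (a + k * ((b - a) / n)) = (b - a) / n" for k
      by (simp only: of_nat_Suc distrib_right)
    ultimately show "mesh n (\<lambda>k. a + k * ((b - a) / n)) \<le> \<delta>"
      unfolding mesh_def using assms(2) by (intro Max.boundedI) (auto simp del: of_nat_Suc)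
  qed
qed

section \<open>Existence of joint motions\<close>

lemma guide_cong:
  assumes "\<And>i. i \<le> k \<Longrightarrow> x (\<tau> i) = y (\<tau> i)"
  shows "guide U \<tau> x k = guide U \<tau> y k"
  using assms by (induction k) auto

lemma step_ctrl_cong:
  assumes "\<And>i. i \<le> k \<Longrightarrow> x (\<tau> i) = y (\<tau> i)"
  shows "step_ctrl U \<tau> x k = step_ctrl U \<tau> y k"
  unfolding step_ctrl_def using guide_cong[of k x \<tau> y U] assms by simp

lemma step_ctrl_mem:
  assumes "control_with_guide T C U" "\<And>i. i \<le> k \<Longrightarrow> \<tau> i \<in> {0..T}"
  shows "step_ctrl U \<tau> x k \<in> C"
proof -
  obtain m where m: "\<forall>t\<in>{0..T}. \<forall>x. \<forall>w\<in>topspace (Euclidean_space m). ctrl U t x w \<in> C"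
    "\<forall>t\<in>{0..T}. \<forall>s\<in>{0..T}. \<forall>x. \<forall>w\<in>topspace (Euclidean_space m).
       guide_step U t s x w \<in> topspace (Euclidean_space m)"
    "\<forall>t\<in>{0..T}. \<forall>x. guide_init U t x \<in> topspace (Euclidean_space m)"
    using assms(1) unfolding control_with_guide_def by blast
  have "guide U \<tau> x k \<in> topspace (Euclidean_space m)"
    using assms(2) by (induction k) (use m in auto)
  then show ?thesis using m(1) assms(2)[of k] unfolding step_ctrl_def by blast
qed

context controlled_system
begin

text \<open>The infimum over an empty set of motions would be \<open>\<infinity>\<close>, so the joint payoff equals the prescribed
number only if there are joint motions on arbitrarily fine partitions. They are glued together from one
solution per step; the controls of a step depend only on the states at the nodes up
to its beginning (\<open>step_ctrl_cong\<close>).\<close>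

lemma motionc_exists:
  assumes U: "control_with_guide T P U" and V: "control_with_guide T Q V"
    and part: "is_partition t0 T r \<tau>" and "0 \<le> t0"
    and small: "\<And>k. k < r \<Longrightarrow> 2 * K * (\<tau> (Suc k) - \<tau> k) < 1"
  shows "\<exists>x. motionc f g t0 x0 U V r \<tau> x"
proof -
  have "n \<le> r \<Longrightarrow> \<exists>x. motionc f g t0 x0 U V n \<tau> x" for n
  proof (induction n)
    case 0
    show ?case by (rule exI[of _ "\<lambda>_. x0"]) (simp add: motionc_def)
  next
    case (Suc n)
    then obtain x where x: "motionc f g t0 x0 U V n \<tau> x" by auto
    have mem: "\<tau> i \<in> {0..T}" if "i \<le> r" for i
      using partition_bounds[OF part that] \<open>0 \<le> t0\<close> by auto
    have lt: "\<tau> n < \<tau> (Suc n)" using part Suc.prems by (simp add: is_partition_def)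
    obtain y where y: "y (\<tau> n) = x (\<tau> n)"
      "solves_on f g (\<lambda>_. step_ctrl U \<tau> x n) (\<lambda>_. step_ctrl V \<tau> x n) (\<tau> n) (\<tau> (Suc n)) y"
    proof (rule constant_control_solution[of "step_ctrl U \<tau> x n" "step_ctrl V \<tau> x n" "\<tau> n" "\<tau> (Suc n)"])
      show "step_ctrl U \<tau> x n \<in> P" "step_ctrl V \<tau> x n \<in> Q"
        using Suc.prems mem by (auto intro!: step_ctrl_mem[OF U] step_ctrl_mem[OF V])
      show "0 \<le> \<tau> n" "\<tau> n \<le> \<tau> (Suc n)" "\<tau> (Suc n) \<le> T"
        using mem[of n] mem[of "Suc n"] Suc.prems lt by auto
      show "2 * K * (\<tau> (Suc n) - \<tau> n) < 1" using small Suc.prems by simp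
    qed auto
    define z where "z t = (if t \<le> \<tau> n then x t else y t)" for t
    have zx: "z (\<tau> i) = x (\<tau> i)" if "i \<le> n" for i
      using partition_mono[OF part that] Suc.prems by (simp add: z_def)
    have ctrl: "step_ctrl U \<tau> z k = step_ctrl U \<tau> x k" "step_ctrl V \<tau> z k = step_ctrl V \<tau> x k"
      if "k \<le> n" for k
      using that zx by (auto intro!: step_ctrl_cong)
    have "z t0 = x0"
      using zx[of 0] x part by (simp add: motionc_def is_partition_def)
    moreover have "solves_on f g (\<lambda>_. step_ctrl U \<tau> z k) (\<lambda>_. step_ctrl V \<tau> z k) (\<tau> k) (\<tau> (Suc k)) z"
      if "k < Suc n" for k
    proof (cases "k = n")
      case True
      show ?thesis
        unfolding ctrl[OF that[unfolded less_Suc_eq_le]] unfolding True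
        by (rule solves_on_cong[OF y(2)]) (auto simp: z_def y(1))
    next
      case False
      with that have "k < n" by simp
      then have "solves_on f g (\<lambda>_. step_ctrl U \<tau> x k) (\<lambda>_. step_ctrl V \<tau> x k) (\<tau> k) (\<tau> (Suc k)) x"
        using x by (simp add: motionc_def)
      moreover have "\<tau> (Suc k) \<le> \<tau> n"
        using partition_mono[OF part, of "Suc k" n] \<open>k < n\<close> Suc.prems by simp
      ultimately show ?thesis
        unfolding ctrl[OF that[unfolded less_Suc_eq_le]]
        by (elim solves_on_cong) (auto simp: z_def)
    qed
    ultimately have "motionc f g t0 x0 U V (Suc n) \<tau> z"
      unfolding motionc_def by simp
    then show ?case by blast
  qed
  then show ?thesis by blast
qed

end

section \<open>A strategy that follows a plan and punishes deviations\<close>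

text \<open>The entries are: whether an alarm was raised at an earlier node, the accumulated error, the pair attached to
the guide point, and the guide point.\<close>

type_synonym 'x guide_state = "bool \<times> real \<times> (real \<times> real) \<times> 'x"

definition basis_enum :: "nat \<Rightarrow> 'x::euclidean_space" where
  "basis_enum = (SOME e. bij_betw e {0..<DIM('x)} Basis)"

text \<open>A guide value has to be a vector in some \<open>\<real>\<^sup>m\<close>. Here \<open>m = 4 + DIM('x)\<close>: the point occupies the
coordinates from \<open>4\<close> on.\<close>

definition encode :: "'x::euclidean_space guide_state \<Rightarrow> nat \<Rightarrow> real" where
  "encode = (\<lambda>(alarm, D, J, w) i.
     if i = 0 then of_bool alarm else if i = 1 then D else if i = 2 then fst J
     else if i = 3 then snd J else if i < 4 + DIM('x) then w \<bullet> basis_enum (i - 4) else 0)"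

definition decode :: "(nat \<Rightarrow> real) \<Rightarrow> 'x::euclidean_space guide_state" where
  "decode = inv encode"

lemma encode_in_Euclidean_space:
  "encode (s :: 'x::euclidean_space guide_state) \<in> topspace (Euclidean_space (4 + DIM('x)))"
  by (auto simp: topspace_Euclidean_space encode_def split: prod.splits)

lemma decode_encode [simp]: "decode (encode s) = (s :: 'x::euclidean_space guide_state)"
proof -
  have bij: "bij_betw (basis_enum :: nat \<Rightarrow> 'x) {0..<DIM('x)} Basis"
    using someI_ex[OF ex_bij_betw_nat_finite[OF finite_Basis]] unfolding basis_enum_def .
  have "inj (encode :: 'x guide_state \<Rightarrow> _)"
  proof (rule injI)
    fix s s' :: "'x guide_state" assume eq: "encode s = encode s'"
    obtain al D J1 J2 w where s: "s = (al, D, (J1, J2), w)" by (metis prod.collapse)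
    obtain al' D' J1' J2' w' where s': "s' = (al', D', (J1', J2'), w')" by (metis prod.collapse)
    have i: "encode s i = encode s' i" for i using eq by simp
    have "w = w'"
    proof (rule euclidean_eqI)
      fix b :: 'x assume "b \<in> Basis"
      then obtain j where "j < DIM('x)" "b = basis_enum j"
        using bij unfolding bij_betw_def by force
      then show "w \<bullet> b = w' \<bullet> b" using i[of "4 + j"] by (simp add: encode_def s s')
    qed
    moreover have "al = al'" using i[of 0] by (cases al; cases al') (simp_all add: encode_def s s')
    ultimately show "s = s'" using i[of 1] i[of 2] i[of 3] by (simp add: encode_def s s')
  qed
  then show ?thesis by (simp add: decode_def)
qed

text \<open>A closed form for the recursion of the accumulated error when \<open>\<phi>\<close> is at most \<open>\<epsilon>\<close>: \<open>a\<close> is the time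
elapsed. The parameters \<open>p\<close> and \<open>q\<close> leave room for the jump of the distance when an alarm is
raised.\<close>

lemma error_accumulation:
  fixes \<beta> h a p q \<epsilon> :: real
  assumes "0 \<le> \<beta>" "0 \<le> h" "0 \<le> a" "1 \<le> p" "0 \<le> q" "0 \<le> \<epsilon>"
  shows "(1 + \<beta> * h) * (exp (\<beta> * a) * (p * a * \<epsilon> + q)) + h * \<epsilon>
    \<le> exp (\<beta> * (a + h)) * (p * (a + h) * \<epsilon> + q)"
proof -
  have "(1 + \<beta> * h) * (exp (\<beta> * a) * (p * a * \<epsilon> + q)) \<le> exp (\<beta> * h) * (exp (\<beta> * a) * (p * a * \<epsilon> + q))"
    using assms exp_ge_add_one_self[of "\<beta> * h"] by (intro mult_right_mono) auto
  also have "\<dots> = exp (\<beta> * (a + h)) * (p * a * \<epsilon> + q)"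
    by (simp add: distrib_left exp_add mult_ac)
  finally have 1: "(1 + \<beta> * h) * (exp (\<beta> * a) * (p * a * \<epsilon> + q)) \<le> exp (\<beta> * (a + h)) * (p * a * \<epsilon> + q)" .
  have "1 * (h * \<epsilon>) \<le> p * (h * \<epsilon>)" using assms by (intro mult_right_mono) auto
  also have "1 * (p * (h * \<epsilon>)) \<le> exp (\<beta> * (a + h)) * (p * (h * \<epsilon>))"
    using assms by (intro mult_right_mono) auto
  finally show ?thesis using 1 by (simp add: algebra_simps)
qed

text \<open>The player who owns \<open>f\<close> and \<open>P\<close> plays against an opponent whose payoff is the entry \<open>c\<close> of the pairs
in \<open>S\<close>. The choice \<open>plan\<close> of planned points is a parameter because both players have to make the same
choice.\<close>

locale tracking = controlled_system T K P Q f g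
  for T K :: real
    and P :: "'p::metric_space set" and Q :: "'q::metric_space set"
    and f :: "real \<Rightarrow> 'x::euclidean_space \<Rightarrow> 'p \<Rightarrow> 'x"
    and g :: "real \<Rightarrow> 'x \<Rightarrow> 'q \<Rightarrow> 'x" +
  fixes S :: "real \<Rightarrow> 'x \<Rightarrow> (real \<times> real) set"
    and plan :: "real \<Rightarrow> real \<Rightarrow> 'x \<Rightarrow> real \<times> real \<Rightarrow> 'x"
    and c :: "real \<times> real \<Rightarrow> real"
    and J0 :: "real \<Rightarrow> 'x \<Rightarrow> real \<times> real"
    and R :: real and \<phi> :: "real \<Rightarrow> real"
  assumes plan: "\<lbrakk>0 \<le> t; t \<le> t'; t' \<le> T; J \<in> S t w\<rbrakk>
      \<Longrightarrow> plan t' t w J \<in> attainable f g P Q t w t' \<and> J \<in> S t' (plan t' t w J)"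
    and punishable: "\<lbrakk>0 \<le> t; t \<le> t'; t' \<le> T; J \<in> S t w; v \<in> Q\<rbrakk>
      \<Longrightarrow> \<exists>w'\<in>attainable f g P {v} t w t'. \<exists>J'\<in>S t' w'. c J' \<le> c J"
    and selector: "t \<in> {0..T} \<Longrightarrow> J0 t x \<in> S t x"
    and R_nonneg: "0 \<le> R"
    and error_rate: "0 < \<epsilon> \<Longrightarrow>
      \<exists>\<delta>>0. \<forall>h. 0 < h \<longrightarrow> h \<le> \<delta> \<longrightarrow> \<phi> h \<le> \<epsilon> \<and> shift_bound T K P Q f g R h (\<phi> h)"
begin

text \<open>The control rule is the same before and after an alarm; only the motion of the guide changes.\<close>

definition aim :: "real \<Rightarrow> 'x \<Rightarrow> 'x \<Rightarrow> 'p" where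
  "aim t x w = (SOME u. u \<in> P \<and> (\<forall>a\<in>P. (x - w) \<bullet> f t x u \<le> (x - w) \<bullet> f t x a))"

text \<open>The control of the opponent that drives \<open>x\<close> away from \<open>w\<close> most strongly. A guide that moves under this
control cannot be outrun by \<open>x\<close>.\<close>

definition threat :: "real \<Rightarrow> 'x \<Rightarrow> 'x \<Rightarrow> 'q" where
  "threat t x w = (SOME v. v \<in> Q \<and> (\<forall>b\<in>Q. (x - w) \<bullet> g t x b \<le> (x - w) \<bullet> g t x v))"

definition punish :: "real \<Rightarrow> real \<Rightarrow> 'x \<Rightarrow> real \<times> real \<Rightarrow> 'q \<Rightarrow> (real \<times> real) \<times> 'x" where
  "punish t' t w J v = (SOME (J', w'). w' \<in> attainable f g P {v} t w t' \<and> J' \<in> S t' w' \<and> c J' \<le> c J)"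

text \<open>The alarm test uses the state \<open>x\<close> at the old node, because the state at the new node is not yet an
argument of the guide function.\<close>

definition advance :: "real \<Rightarrow> real \<Rightarrow> 'x \<Rightarrow> 'x guide_state \<Rightarrow> 'x guide_state" where
  "advance t' t x = (\<lambda>(alarm, D, J, w).
     if alarm \<or> D < (norm (x - w))\<^sup>2 then (True, D, punish t' t w J (threat t x w))
     else (False, (1 + 4 * K * (t' - t)) * D + (t' - t) * \<phi> (t' - t), J, plan t' t w J))"

definition strategy :: "('x, 'p) guide_strategy" where
  "strategy = \<lparr>ctrl = \<lambda>t x s. case decode s of (alarm, D, J, w) \<Rightarrow> aim t x w,
     guide_step = \<lambda>t' t x s. encode (advance t' t x (decode s)),
     guide_init = \<lambda>t x. encode (False, 0, J0 t x, x)\<rparr>"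

definition state :: "(nat \<Rightarrow> real) \<Rightarrow> (real \<Rightarrow> 'x) \<Rightarrow> nat \<Rightarrow> 'x guide_state" where
  "state \<tau> x k = decode (guide strategy \<tau> x k)"

lemma state_0: "state \<tau> x 0 = (False, 0, J0 (\<tau> 0) (x (\<tau> 0)), x (\<tau> 0))"
  by (simp add: state_def strategy_def)

lemma state_Suc: "state \<tau> x (Suc k) = advance (\<tau> (Suc k)) (\<tau> k) (x (\<tau> k)) (state \<tau> x k)"
  by (simp add: state_def strategy_def)

lemma step_ctrl_strategy:
  "state \<tau> x k = (alarm, D, J, w) \<Longrightarrow> step_ctrl strategy \<tau> x k = aim (\<tau> k) (x (\<tau> k)) w"
  by (simp add: state_def step_ctrl_def strategy_def)

lemma aim:
  assumes "t \<in> {0..T}"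
  shows "aim t x w \<in> P" "a \<in> P \<Longrightarrow> (x - w) \<bullet> (f t x (aim t x w) - f t x a) \<le> 0"
proof -
  have "continuous_on P (\<lambda>u. (\<lambda>(t, x, u). f t x u) (t, x, u))"
    by (rule continuous_on_compose2[OF continuous_f]) (use assms in \<open>auto intro!: continuous_intros\<close>)
  then have "continuous_on P (\<lambda>u. (x - w) \<bullet> f t x u)"
    by (auto intro!: continuous_intros)
  then have "\<exists>u. u \<in> P \<and> (\<forall>a\<in>P. (x - w) \<bullet> f t x u \<le> (x - w) \<bullet> f t x a)"
    using continuous_attains_inf[OF compact_P P_nonempty] by blast
  from someI_ex[OF this] show "aim t x w \<in> P" "a \<in> P \<Longrightarrow> (x - w) \<bullet> (f t x (aim t x w) - f t x a) \<le> 0"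
    unfolding aim_def by (auto simp: inner_diff_right)
qed

lemma threat:
  assumes "t \<in> {0..T}"
  shows "threat t x w \<in> Q" "b \<in> Q \<Longrightarrow> (x - w) \<bullet> (g t x b - g t x (threat t x w)) \<le> 0"
proof -
  have "continuous_on Q (\<lambda>v. (\<lambda>(t, x, v). g t x v) (t, x, v))"
    by (rule continuous_on_compose2[OF continuous_g]) (use assms in \<open>auto intro!: continuous_intros\<close>)
  then have "continuous_on Q (\<lambda>v. (x - w) \<bullet> g t x v)"
    by (auto intro!: continuous_intros)
  then have "\<exists>v. v \<in> Q \<and> (\<forall>b\<in>Q. (x - w) \<bullet> g t x b \<le> (x - w) \<bullet> g t x v)"
    using continuous_attains_sup[OF compact_Q Q_nonempty] by blast
  from someI_ex[OF this] show "threat t x w \<in> Q" "b \<in> Q \<Longrightarrow> (x - w) \<bullet> (g t x b - g t x (threat t x w)) \<le> 0"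
    unfolding threat_def by (auto simp: inner_diff_right)
qed

lemma punish:
  assumes "0 \<le> t" "t \<le> t'" "t' \<le> T" "J \<in> S t w" "v \<in> Q" "punish t' t w J v = (J', w')"
  shows "w' \<in> attainable f g P {v} t w t'" "J' \<in> S t' w'" "c J' \<le> c J"
proof -
  have "\<exists>p. case p of (J', w') \<Rightarrow> w' \<in> attainable f g P {v} t w t' \<and> J' \<in> S t' w' \<and> c J' \<le> c J"
    using punishable[OF assms(1-5)] by blast
  from someI_ex[OF this] show "w' \<in> attainable f g P {v} t w t'" "J' \<in> S t' w'" "c J' \<le> c J"
    using assms(6) unfolding punish_def by auto
qed

lemma control_with_guide_strategy: "control_with_guide T P strategy"
  unfolding control_with_guide_def
  by (intro exI[of _ "4 + DIM('x)"])
    (auto simp: strategy_def aim intro!: encode_in_Euclidean_space split: prod.split)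

text \<open>The control of \<open>x\<close> is extremal against all of \<open>P\<close>, and any control of the opponent is extremal
against the threat, which the guide is moved by.\<close>

lemma pursuit_step:
  assumes "0 \<le> s" "s < t" "t \<le> T" and J: "J \<in> S s w"
    and x: "solves_on f g (\<lambda>_. aim s (x s) w) v s t x" and v: "\<And>\<tau>. \<tau> \<in> {s..t} \<Longrightarrow> v \<tau> \<in> Q"
    and R: "norm (x s) \<le> R" "norm w \<le> R"
    and bound: "shift_bound T K P Q f g R (t - s) \<epsilon>"
    and p: "punish t s w J (threat s (x s) w) = (J', w')"
  shows "(norm (x t - w'))\<^sup>2 \<le> (1 + 4 * K * (t - s)) * (norm (x s - w))\<^sup>2 + (t - s) * \<epsilon>"
proof -
  have s: "s \<in> {0..T}" using assms by auto
  have "w' \<in> attainable f g P {threat s (x s) w} s w t"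
    using assms threat[OF s] by (intro punish[OF _ _ _ J _ p]) auto
  moreover note bound[unfolded shift_bound_def, rule_format,
      of s x w P "{threat s (x s) w}" "\<lambda>_. aim s (x s) w" v w']
  ultimately show ?thesis
    using assms aim[OF s] threat[OF s] by auto
qed

text \<open>Induction over the nodes. As long as there is no alarm, \<open>D\<close> is at most \<open>exp (4 * K * a) * a * \<epsilon>\<close> after
time \<open>a\<close>. In the step in which the distance may exceed this bound unnoticed, both \<open>x\<close> and \<open>w\<close> move by at
most \<open>speed T K R * \<delta>\<close>, so by \<open>(\<alpha> + \<beta>)\<^sup>2 \<le> 2 * \<alpha>\<^sup>2 + 2 * \<beta>\<^sup>2\<close> the squared distance is at most twice the
bound plus \<open>8 * (speed T K R * \<delta>)\<^sup>2\<close>. A bound of this form survives every punishing step by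
\<open>error_accumulation\<close> with \<open>p = 2\<close>, while the recursion of \<open>D\<close> itself is the case \<open>p = 1\<close>, \<open>q = 0\<close>.\<close>

lemma pursuit:
  assumes part: "is_partition t0 T r \<tau>" "mesh r \<tau> \<le> \<delta>" and "0 \<le> t0" and "0 \<le> \<epsilon>" "0 \<le> \<delta>"
    and \<phi>: "\<And>h. \<lbrakk>0 < h; h \<le> \<delta>\<rbrakk> \<Longrightarrow> \<phi> h \<le> \<epsilon> \<and> shift_bound T K P Q f g R h (\<phi> h)"
    and x: "motion1 f g t0 x0 strategy r \<tau> v x" and v: "\<And>t. t \<in> {0..T} \<Longrightarrow> v t \<in> Q"
    and x0: "(1 + norm x0) * exp (2 * K * T) \<le> 1 + R"
  obtains w J where "J \<in> S T w" "c J \<le> c (J0 t0 x0)" "norm w \<le> R" "norm (x T) \<le> R"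
    "(norm (x T - w))\<^sup>2 \<le> exp (4 * K * (T - t0)) * (2 * (T - t0) * \<epsilon> + 8 * (speed T K R * \<delta>)\<^sup>2)"
proof -
  define q where "q = 8 * (speed T K R * \<delta>)\<^sup>2"
  \<comment> \<open>a growth bound that is common to the motion and to the guide and keeps both in the ball of radius R\<close>
  define b where "b t = (1 + norm x0) * exp (2 * K * (t - t0))" for t
  have b_le: "b t \<le> 1 + R" if "t \<le> T" for t
  proof -
    have "b t \<le> (1 + norm x0) * exp (2 * K * T)"
      unfolding b_def using that K_nonneg \<open>0 \<le> t0\<close> by (intro mult_left_mono) (auto intro: mult_left_mono)
    then show ?thesis using x0 by simp
  qed
  have b_step: "b s * exp (2 * K * (t - s)) = b t" for s t
    unfolding b_def by (simp add: exp_add[symmetric] algebra_simps)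
  have xt0: "x t0 = x0" and \<tau>0: "\<tau> 0 = t0" and \<tau>r: "\<tau> r = T"
    using x part by (auto simp: motion1_def is_partition_def)
  have inv: "k \<le> r \<Longrightarrow> \<exists>alarm D J w. state \<tau> x k = (alarm, D, J, w) \<and> J \<in> S (\<tau> k) w \<and>
      c J \<le> c (J0 t0 x0) \<and> 1 + norm w \<le> b (\<tau> k) \<and> 1 + norm (x (\<tau> k)) \<le> b (\<tau> k) \<and>
      (norm (x (\<tau> k) - w))\<^sup>2 \<le> exp (4 * K * (\<tau> k - t0)) * (2 * (\<tau> k - t0) * \<epsilon> + q) \<and>
      (\<not> alarm \<longrightarrow> D \<le> exp (4 * K * (\<tau> k - t0)) * (1 * (\<tau> k - t0) * \<epsilon> + 0))" for k
  proof (induction k)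
    case 0
    have "J0 t0 x0 \<in> S t0 x0"
      using selector[of t0] partition_bounds[OF part(1), of 0] \<tau>0 \<open>0 \<le> t0\<close> by auto
    then show ?case unfolding state_0 \<tau>0 xt0 by (auto simp: b_def q_def)
  next
    case (Suc k)
    define s t where "s = \<tau> k" and "t = \<tau> (Suc k)"
    define a where "a = s - t0"
    have st: "0 < t - s" "t - s \<le> \<delta>"
      using partition_step[OF part, of k] Suc.prems by (auto simp: s_def t_def)
    have a: "0 \<le> a" and s0: "0 \<le> s" and tT: "t \<le> T"
      using partition_bounds[OF part(1), of k] partition_bounds[OF part(1), of "Suc k"] Suc.prems \<open>0 \<le> t0\<close>
      by (auto simp: a_def s_def t_def)
    have ta: "t - t0 = a + (t - s)" by (simp add: a_def)
    obtain alarm D J w where ih: "state \<tau> x k = (alarm, D, J, w)" "J \<in> S s w" "c J \<le> c (J0 t0 x0)"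
      "1 + norm w \<le> b s" "1 + norm (x s) \<le> b s"
      "(norm (x s - w))\<^sup>2 \<le> exp (4 * K * a) * (2 * a * \<epsilon> + q)"
      "\<not> alarm \<longrightarrow> D \<le> exp (4 * K * a) * (1 * a * \<epsilon> + 0)"
      using Suc by (auto simp: s_def a_def)
    have R: "norm w \<le> R" "norm (x s) \<le> R"
      using ih(4,5) b_le[of s] st tT by auto
    have "solves_on f g (\<lambda>_. step_ctrl strategy \<tau> x k) v (\<tau> k) (\<tau> (Suc k)) x"
      using x Suc.prems by (simp add: motion1_def)
    then have xs: "solves_on f g (\<lambda>_. aim s (x s) w) v s t x"
      unfolding step_ctrl_strategy[OF ih(1)] s_def t_def .
    have mem: "s \<in> {0..T}" "aim s (x s) w \<in> P" "\<And>\<theta>. \<theta> \<in> {s..t} \<Longrightarrow> v \<theta> \<in> Q"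
      using s0 st tT v aim(1)[of s] by auto
    have bound: "\<phi> (t - s) \<le> \<epsilon>" "shift_bound T K P Q f g R (t - s) (\<phi> (t - s))"
      using \<phi>[OF st] by auto
    have hphi: "(t - s) * \<phi> (t - s) \<le> (t - s) * \<epsilon>" using bound st by simp
    have q: "0 \<le> q" by (simp add: q_def)
    have xt: "1 + norm (x t) \<le> b t"
    proof -
      have "1 + norm (x t) \<le> (1 + norm (x s)) * exp (2 * K * (t - s))"
        using s0 st tT mem by (intro solution_growth[OF xs]) auto
      also have "\<dots> \<le> b s * exp (2 * K * (t - s))" using ih(5) by (intro mult_right_mono) auto
      finally show ?thesis using b_step by simp
    qed
    have bw: "1 + norm w' \<le> b t" if "w' \<in> attainable f g P B s w t" "B \<subseteq> Q" for w' B
    proof -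
      have "1 + norm w' \<le> (1 + norm w) * exp (2 * K * (t - s))"
        using s0 st tT that by (intro attainable_growth[OF that(1)]) auto
      also have "\<dots> \<le> b s * exp (2 * K * (t - s))" using ih(4) by (intro mult_right_mono) auto
      finally show ?thesis using b_step by simp
    qed
    have next_state: "state \<tau> x (Suc k) = advance t s (x s) (alarm, D, J, w)"
      unfolding state_Suc ih(1) s_def t_def ..
    show ?case
    proof (cases "alarm \<or> D < (norm (x s - w))\<^sup>2")
      case True
      obtain J' w' where p: "punish t s w J (threat s (x s) w) = (J', w')" by fastforce
      have w': "w' \<in> attainable f g P {threat s (x s) w} s w t" "J' \<in> S t w'" "c J' \<le> c J"
        using punish[OF _ _ _ ih(2) _ p] s0 st tT threat(1)[OF mem(1)] by auto
      have "(norm (x t - w'))\<^sup>2 \<le> (1 + 4 * K * (t - s)) * (norm (x s - w))\<^sup>2 + (t - s) * \<phi> (t - s)"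
        by (rule pursuit_step[OF s0 _ tT ih(2) xs _ R(2,1) bound(2) p]) (use st mem in auto)
      also have "\<dots> \<le> (1 + 4 * K * (t - s)) * (exp (4 * K * a) * (2 * a * \<epsilon> + q)) + (t - s) * \<epsilon>"
        using ih(6) hphi K_nonneg st by (intro add_mono mult_left_mono) auto
      also have "\<dots> \<le> exp (4 * K * (t - t0)) * (2 * (t - t0) * \<epsilon> + q)"
        unfolding ta using K_nonneg st a q \<open>0 \<le> \<epsilon>\<close> by (intro error_accumulation) auto
      finally have "(norm (x t - w'))\<^sup>2 \<le> exp (4 * K * (t - t0)) * (2 * (t - t0) * \<epsilon> + q)" .
      moreover have "1 + norm w' \<le> b t"
        using bw[OF w'(1)] threat(1)[OF mem(1)] by auto
      ultimately show ?thesis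
        unfolding next_state advance_def t_def[symmetric] using True p w' xt ih(3) by auto
    next
      case False
      define w' where "w' = plan t s w J"
      have w': "w' \<in> attainable f g P Q s w t" "J \<in> S t w'"
        using plan[OF s0 _ tT ih(2)] st by (auto simp: w'_def)
      let ?D' = "(1 + 4 * K * (t - s)) * D + (t - s) * \<phi> (t - s)"
      have D: "D \<le> exp (4 * K * a) * (1 * a * \<epsilon> + 0)" using False ih(7) by auto
      have "?D' \<le> (1 + 4 * K * (t - s)) * (exp (4 * K * a) * (1 * a * \<epsilon> + 0)) + (t - s) * \<epsilon>"
        using D hphi K_nonneg st by (intro add_mono mult_left_mono) auto
      also have "\<dots> \<le> exp (4 * K * (t - t0)) * (1 * (t - t0) * \<epsilon> + 0)"
        unfolding ta using K_nonneg st a \<open>0 \<le> \<epsilon>\<close> by (intro error_accumulation) auto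
      finally have D': "?D' \<le> exp (4 * K * (t - t0)) * (1 * (t - t0) * \<epsilon> + 0)" .
      have "norm (x t - x s) \<le> speed T K R * (t - s)"
        using s0 st tT mem R by (intro solution_speed[OF xs]) auto
      moreover have "norm (w' - w) \<le> speed T K R * (t - s)"
        using s0 st tT R by (intro attainable_speed[OF w'(1)]) auto
      moreover have "speed T K R * (t - s) \<le> speed T K R * \<delta>"
        using st K_nonneg R_nonneg by (intro mult_left_mono) auto
      ultimately have jump: "norm ((x t - x s) - (w' - w)) \<le> 2 * (speed T K R * \<delta>)"
        using norm_triangle_ineq4[of "x t - x s" "w' - w"] by linarith
      have "(norm (x t - w'))\<^sup>2 = (norm ((x s - w) + ((x t - x s) - (w' - w))))\<^sup>2"
        by (simp add: algebra_simps)
      also have "\<dots> \<le> (norm (x s - w) + norm ((x t - x s) - (w' - w)))\<^sup>2"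
        by (intro power_mono norm_triangle_ineq) auto
      also have "\<dots> \<le> 2 * (norm (x s - w))\<^sup>2 + 2 * (norm ((x t - x s) - (w' - w)))\<^sup>2"
        using sum_squares_bound[of "norm (x s - w)" "norm ((x t - x s) - (w' - w))"]
        by (simp add: power2_sum)
      also have "\<dots> \<le> 2 * D + 2 * (2 * (speed T K R * \<delta>))\<^sup>2"
        using False jump by (intro add_mono mult_left_mono power_mono) auto
      also have "\<dots> \<le> exp (4 * K * a) * (2 * a * \<epsilon>) + 1 * q"
        using D by (simp add: q_def power_mult_distrib)
      also have "\<dots> \<le> exp (4 * K * (t - t0)) * (2 * (t - t0) * \<epsilon>) + exp (4 * K * (t - t0)) * q"
        unfolding ta using K_nonneg st a q \<open>0 \<le> \<epsilon>\<close>
        by (intro add_mono mult_mono mult_right_mono) (auto intro!: mult_left_mono mult_right_mono)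
      finally have "(norm (x t - w'))\<^sup>2 \<le> exp (4 * K * (t - t0)) * (2 * (t - t0) * \<epsilon> + q)"
        by (simp only: distrib_left)
      then show ?thesis
        unfolding next_state advance_def t_def[symmetric] using False w' xt ih(3) D' bw[OF w'(1)]
        by (auto simp: w'_def)
    qed
  qed
  from inv[of r] obtain alarm D J w where "J \<in> S T w" "c J \<le> c (J0 t0 x0)" "1 + norm w \<le> b T"
    "1 + norm (x T) \<le> b T" "(norm (x T - w))\<^sup>2 \<le> exp (4 * K * (T - t0)) * (2 * (T - t0) * \<epsilon> + q)"
    unfolding \<tau>r by auto
  then show thesis using that[of J w] b_le[of T] unfolding q_def by auto
qed

end

section \<open>Limits over partitions\<close>

text \<open>\<open>Lim\<close> is a description operator, so the existence of the limit is part of the claim; it follows from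
monotonicity in \<open>\<delta>\<close>.\<close>

lemma Lim_Sup_le:
  fixes A :: "real \<Rightarrow> ereal set"
  assumes mono: "\<And>\<delta> \<delta>'. \<delta> \<le> \<delta>' \<Longrightarrow> A \<delta> \<subseteq> A \<delta>'"
    and le: "\<And>e. 0 < e \<Longrightarrow> \<exists>\<delta>>0. \<forall>z\<in>A \<delta>. z \<le> ereal (J + e)"
  shows "Lim (at_right 0) (\<lambda>\<delta>. Sup (A \<delta>)) \<le> ereal J"
proof -
  let ?F = "\<lambda>\<delta>. Sup (A \<delta>)"
  have "(?F \<longlongrightarrow> (INF \<delta>\<in>{0<..}. ?F \<delta>)) (at_right 0)"
  proof (rule order_tendstoI)
    fix a assume "a < (INF \<delta>\<in>{0<..}. ?F \<delta>)"
    then have "a < ?F \<delta>" if "0 < \<delta>" for \<delta>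
      by (rule less_le_trans) (use that in \<open>intro INF_lower; simp\<close>)
    then show "\<forall>\<^sub>F \<delta> in at_right 0. a < ?F \<delta>"
      by (intro eventually_at_rightI[of 0 1]) auto
  next
    fix a assume "(INF \<delta>\<in>{0<..}. ?F \<delta>) < a"
    then obtain \<delta> where \<delta>: "0 < \<delta>" "?F \<delta> < a" by (auto simp: INF_less_iff)
    have "?F \<delta>' < a" if "\<delta>' \<in> {0<..<\<delta>}" for \<delta>'
      using Sup_subset_mono[OF mono[of \<delta>' \<delta>]] that \<delta> by (auto intro: le_less_trans)
    then show "\<forall>\<^sub>F \<delta> in at_right 0. ?F \<delta> < a"
      using \<delta> by (intro eventually_at_rightI[of 0 \<delta>]) auto
  qed
  then have "Lim (at_right 0) ?F = (INF \<delta>\<in>{0<..}. ?F \<delta>)"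
    by (intro tendsto_Lim trivial_limit_at_right_real)
  also have "\<dots> \<le> ereal J"
  proof (rule ereal_le_epsilon2)
    fix e :: real assume "0 < e"
    then obtain \<delta> where \<delta>: "0 < \<delta>" "\<forall>z\<in>A \<delta>. z \<le> ereal (J + e)" using le by blast
    then have "(INF \<delta>\<in>{0<..}. ?F \<delta>) \<le> ?F \<delta>" by (intro INF_lower) auto
    also have "\<dots> \<le> ereal (J + e)" using \<delta> by (intro Sup_least) auto
    finally show "(INF \<delta>\<in>{0<..}. ?F \<delta>) \<le> ereal J + ereal e" by simp
  qed
  finally show ?thesis .
qed

lemma Lim_Inf_eq:
  fixes A :: "real \<Rightarrow> ereal set"
  assumes mono: "\<And>\<delta> \<delta>'. \<delta> \<le> \<delta>' \<Longrightarrow> A \<delta> \<subseteq> A \<delta>'"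
    and near: "\<And>e. 0 < e \<Longrightarrow> \<exists>\<delta>>0. \<forall>z\<in>A \<delta>. ereal (J - e) \<le> z \<and> z \<le> ereal (J + e)"
    and ne: "\<And>\<delta>. 0 < \<delta> \<Longrightarrow> A \<delta> \<noteq> {}"
  shows "Lim (at_right 0) (\<lambda>\<delta>. Inf (A \<delta>)) = ereal J"
proof -
  let ?F = "\<lambda>\<delta>. Inf (A \<delta>)"
  have "(?F \<longlongrightarrow> (SUP \<delta>\<in>{0<..}. ?F \<delta>)) (at_right 0)"
  proof (rule order_tendstoI)
    fix a assume "(SUP \<delta>\<in>{0<..}. ?F \<delta>) < a"
    then have "?F \<delta> < a" if "0 < \<delta>" for \<delta>
      by (rule le_less_trans[rotated]) (use that in \<open>intro SUP_upper; simp\<close>)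
    then show "\<forall>\<^sub>F \<delta> in at_right 0. ?F \<delta> < a"
      by (intro eventually_at_rightI[of 0 1]) auto
  next
    fix a assume "a < (SUP \<delta>\<in>{0<..}. ?F \<delta>)"
    then obtain \<delta> where \<delta>: "0 < \<delta>" "a < ?F \<delta>" by (auto simp: less_SUP_iff)
    have "a < ?F \<delta>'" if "\<delta>' \<in> {0<..<\<delta>}" for \<delta>'
      using Inf_superset_mono[OF mono[of \<delta>' \<delta>]] that \<delta> by (auto intro: less_le_trans)
    then show "\<forall>\<^sub>F \<delta> in at_right 0. a < ?F \<delta>"
      using \<delta> by (intro eventually_at_rightI[of 0 \<delta>]) auto
  qed
  then have "Lim (at_right 0) ?F = (SUP \<delta>\<in>{0<..}. ?F \<delta>)"
    by (intro tendsto_Lim trivial_limit_at_right_real)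
  also have "\<dots> = ereal J"
  proof (rule antisym)
    show "(SUP \<delta>\<in>{0<..}. ?F \<delta>) \<le> ereal J"
    proof (rule SUP_least, rule ereal_le_epsilon2)
      fix \<delta> e :: real assume "\<delta> \<in> {0<..}" "0 < e"
      then obtain \<delta>' where \<delta>': "0 < \<delta>'" "\<forall>z\<in>A \<delta>'. ereal (J - e) \<le> z \<and> z \<le> ereal (J + e)"
        using near by blast
      then obtain z where z: "z \<in> A (min \<delta> \<delta>')" using ne[of "min \<delta> \<delta>'"] \<open>\<delta> \<in> {0<..}\<close> by auto
      then have "z \<in> A \<delta>" "z \<in> A \<delta>'"
        using mono[of "min \<delta> \<delta>'" \<delta>] mono[of "min \<delta> \<delta>'" \<delta>'] by auto
      then have "?F \<delta> \<le> z" "z \<le> ereal (J + e)" using \<delta>' by (auto intro: Inf_lower)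
      then show "?F \<delta> \<le> ereal J + ereal e" by simp
    qed
    show "ereal J \<le> (SUP \<delta>\<in>{0<..}. ?F \<delta>)"
    proof (rule ereal_le_epsilon2)
      fix e :: real assume "0 < e"
      then obtain \<delta> where \<delta>: "0 < \<delta>" "\<forall>z\<in>A \<delta>. ereal (J - e) \<le> z \<and> z \<le> ereal (J + e)"
        using near by blast
      then have "ereal (J - e) \<le> ?F \<delta>" by (intro Inf_greatest) auto
      also have "\<dots> \<le> (SUP \<delta>\<in>{0<..}. ?F \<delta>)" using \<delta> by (intro SUP_upper) auto
      finally have "ereal (J - e) + ereal e \<le> (SUP \<delta>\<in>{0<..}. ?F \<delta>) + ereal e"
        by (rule add_right_mono)
      then show "ereal J \<le> (SUP \<delta>\<in>{0<..}. ?F \<delta>) + ereal e" by simp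
    qed
  qed
  finally show ?thesis .
qed

section \<open>The payoff of a deviation\<close>

lemma motion2_eq_motion1: "motion2 f g t0 x0 V r \<tau> u x \<longleftrightarrow> motion1 g f t0 x0 V r \<tau> u x"
  unfolding motion1_def motion2_def solves_on_commute[of f g] ..

lemma payoff_vs2_eq_payoff_vs1: "payoff_vs2 T f g P \<sigma> V t0 x0 = payoff_vs1 T g f P \<sigma> V t0 x0"
  unfolding payoff_vs1_def payoff_vs2_def motion2_eq_motion1 ..

lemma small_error_parameters:
  fixes E T M \<rho> :: real
  assumes "0 < \<rho>" "0 \<le> T" "0 < E"
  obtains \<epsilon> d where "0 < \<epsilon>" "0 < d"
    "\<And>\<delta>. \<lbrakk>0 < \<delta>; \<delta> \<le> d\<rbrakk> \<Longrightarrow> E * (2 * T * \<epsilon> + 8 * (M * \<delta>)\<^sup>2) < \<rho>\<^sup>2"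
proof -
  define \<epsilon> where "\<epsilon> = \<rho>\<^sup>2 / (4 * E * (T + 1))"
  define d where "d = min 1 (\<rho>\<^sup>2 / (32 * E * (M\<^sup>2 + 1)))"
  have M1: "0 < M\<^sup>2 + 1" and T1: "0 < T + 1" and \<rho>2: "0 < \<rho>\<^sup>2"
    using assms by (auto simp: add_nonneg_pos)
  have pos: "0 < \<epsilon>" "0 < d"
    unfolding \<epsilon>_def d_def using assms(3) M1 T1 \<rho>2 by auto
  have "\<epsilon> * (4 * E * (T + 1)) = \<rho>\<^sup>2"
    unfolding \<epsilon>_def using assms(3) T1 by (intro nonzero_eq_divide_eq[THEN iffD1]) auto
  moreover have "E * (2 * T * \<epsilon>) = \<epsilon> * (4 * E * (T + 1)) / 2 - 2 * (E * \<epsilon>)"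
    by (simp add: algebra_simps)
  moreover have "0 < E * \<epsilon>" using assms(3) pos by simp
  ultimately have 1: "E * (2 * T * \<epsilon>) \<le> \<rho>\<^sup>2 / 2" by linarith
  have 2: "E * (8 * (M * \<delta>)\<^sup>2) \<le> \<rho>\<^sup>2 / 4" if \<delta>: "0 < \<delta>" "\<delta> \<le> d" for \<delta>
  proof -
    have "\<delta> \<le> \<rho>\<^sup>2 / (32 * E * (M\<^sup>2 + 1))" using \<delta> by (simp add: d_def)
    then have *: "\<delta> * (32 * E * (M\<^sup>2 + 1)) \<le> \<rho>\<^sup>2"
      using assms(3) M1 by (subst (asm) pos_le_divide_eq) auto
    have "\<delta> * \<delta> \<le> \<delta> * 1" using \<delta> by (intro mult_left_mono) (auto simp: d_def)
    then have "M\<^sup>2 * \<delta>\<^sup>2 \<le> (M\<^sup>2 + 1) * \<delta>"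
      using \<delta> by (intro mult_mono) (auto simp: power2_eq_square)
    then have "E * (8 * (M * \<delta>)\<^sup>2) \<le> E * (8 * ((M\<^sup>2 + 1) * \<delta>))"
      using assms(3) by (intro mult_left_mono) (auto simp: power_mult_distrib)
    also have "\<dots> = \<delta> * (32 * E * (M\<^sup>2 + 1)) / 4" by simp
    finally show ?thesis using * by linarith
  qed
  show thesis
  proof (rule that[OF pos])
    fix \<delta> assume "0 < \<delta>" "\<delta> \<le> d"
    from 2[OF this] show "E * (2 * T * \<epsilon> + 8 * (M * \<delta>)\<^sup>2) < \<rho>\<^sup>2"
      using 1 \<rho>2 unfolding distrib_left by linarith
  qed
qed

context tracking
begin

text \<open>A choice of accuracy and mesh that turns the distance bounds of \<open>pursuit\<close> and \<open>agreement\<close> into payoff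
differences of at most \<open>e\<close>, uniformly in the initial time.\<close>

lemma payoff_near_guide:
  assumes "continuous_on UNIV (\<sigma> :: 'x \<Rightarrow> real)" "0 < e"
  obtains \<epsilon> \<delta> where "0 < \<epsilon>" "0 < \<delta>"
    and "\<And>h. \<lbrakk>0 < h; h \<le> \<delta>\<rbrakk> \<Longrightarrow> \<phi> h \<le> \<epsilon> \<and> shift_bound T K P Q f g R h (\<phi> h)"
    and "\<And>t0 x w. \<lbrakk>0 \<le> t0; t0 \<le> T; norm x \<le> R; norm w \<le> R;
       (norm (x - w))\<^sup>2 \<le> exp (4 * K * (T - t0)) * (2 * (T - t0) * \<epsilon> + 8 * (speed T K R * \<delta>)\<^sup>2)\<rbrakk>
       \<Longrightarrow> \<bar>\<sigma> x - \<sigma> w\<bar> \<le> e"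
proof -
  have "uniformly_continuous_on (cball 0 R) \<sigma>"
    by (intro compact_uniformly_continuous continuous_on_subset[OF assms(1)]) auto
  then obtain \<rho> where \<rho>: "0 < \<rho>"
    "\<And>x w. \<lbrakk>norm x \<le> R; norm w \<le> R; dist x w < \<rho>\<rbrakk> \<Longrightarrow> dist (\<sigma> x) (\<sigma> w) < e"
    unfolding uniformly_continuous_on_def using \<open>0 < e\<close> by (auto simp: dist_commute)
  obtain \<epsilon> d where \<epsilon>: "0 < \<epsilon>" "0 < d" "\<And>\<delta>. \<lbrakk>0 < \<delta>; \<delta> \<le> d\<rbrakk> \<Longrightarrow>
      exp (4 * K * T) * (2 * T * \<epsilon> + 8 * (speed T K R * \<delta>)\<^sup>2) < \<rho>\<^sup>2"
    using small_error_parameters[OF \<rho>(1) T_nonneg exp_gt_zero] by metis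
  obtain d' where d': "0 < d'"
    "\<And>h. \<lbrakk>0 < h; h \<le> d'\<rbrakk> \<Longrightarrow> \<phi> h \<le> \<epsilon> \<and> shift_bound T K P Q f g R h (\<phi> h)"
    using error_rate[OF \<epsilon>(1)] by auto
  show thesis
  proof (rule that[of \<epsilon> "min d d'"])
    fix t0 and x w :: 'x
    assume *: "0 \<le> t0" "t0 \<le> T" "norm x \<le> R" "norm w \<le> R"
      "(norm (x - w))\<^sup>2 \<le> exp (4 * K * (T - t0)) * (2 * (T - t0) * \<epsilon> + 8 * (speed T K R * min d d')\<^sup>2)"
    note *(5)
    also have "exp (4 * K * (T - t0)) * (2 * (T - t0) * \<epsilon> + 8 * (speed T K R * min d d')\<^sup>2)
        \<le> exp (4 * K * T) * (2 * T * \<epsilon> + 8 * (speed T K R * min d d')\<^sup>2)"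
      using * \<epsilon>(1) K_nonneg by (intro mult_mono add_mono) (auto intro: mult_left_mono)
    also have "\<dots> < \<rho>\<^sup>2" using \<epsilon> d' by auto
    finally have "norm (x - w) < \<rho>" using \<rho>(1) by (simp add: power_less_imp_less_base)
    then show "\<bar>\<sigma> x - \<sigma> w\<bar> \<le> e" using \<rho>(2)[of x w] * by (simp add: dist_norm)
  qed (use \<epsilon> d' in auto)
qed

lemma deviation_payoff_le:
  assumes \<sigma>: "continuous_on UNIV \<sigma>" "\<And>J w. J \<in> S T w \<Longrightarrow> c J = \<sigma> w"
    and "t0 \<in> {0..T}" "(1 + norm x0) * exp (2 * K * T) \<le> 1 + R"
  shows "payoff_vs1 T f g Q \<sigma> strategy t0 x0 \<le> ereal (c (J0 t0 x0))"
  unfolding payoff_vs1_def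
proof (rule Lim_Sup_le)
  fix e :: real assume "0 < e"
  obtain \<epsilon> \<delta> where \<epsilon>: "0 < \<epsilon>" "0 < \<delta>"
    "\<And>h. \<lbrakk>0 < h; h \<le> \<delta>\<rbrakk> \<Longrightarrow> \<phi> h \<le> \<epsilon> \<and> shift_bound T K P Q f g R h (\<phi> h)"
    "\<And>t0 x w. \<lbrakk>0 \<le> t0; t0 \<le> T; norm x \<le> R; norm w \<le> R;
       (norm (x - w))\<^sup>2 \<le> exp (4 * K * (T - t0)) * (2 * (T - t0) * \<epsilon> + 8 * (speed T K R * \<delta>)\<^sup>2)\<rbrakk>
       \<Longrightarrow> \<bar>\<sigma> x - \<sigma> w\<bar> \<le> e"
    using payoff_near_guide[OF \<sigma>(1) \<open>0 < e\<close>] by metis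
  have "\<sigma> (x T) \<le> c (J0 t0 x0) + e"
    if m: "is_partition t0 T r \<tau>" "mesh r \<tau> \<le> \<delta>" "v \<in> controls T Q"
      "motion1 f g t0 x0 strategy r \<tau> v x" for x r \<tau> v
  proof -
    obtain w J where w: "J \<in> S T w" "c J \<le> c (J0 t0 x0)" "norm w \<le> R" "norm (x T) \<le> R"
      "(norm (x T - w))\<^sup>2 \<le> exp (4 * K * (T - t0)) * (2 * (T - t0) * \<epsilon> + 8 * (speed T K R * \<delta>)\<^sup>2)"
      using pursuit[OF m(1,2) _ _ _ \<epsilon>(3) m(4) controls_mem[OF m(3)] assms(4)] \<epsilon>(1,2) assms(3)
      by (metis atLeastAtMost_iff less_imp_le)
    then have "\<bar>\<sigma> (x T) - \<sigma> w\<bar> \<le> e" using \<epsilon>(4) assms(3) by auto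
    then show ?thesis using \<sigma>(2)[OF w(1)] w(2) by linarith
  qed
  then show "\<exists>\<delta>>0. \<forall>z\<in>{ereal (\<sigma> (x T)) | x r \<tau> v. is_partition t0 T r \<tau> \<and> mesh r \<tau> \<le> \<delta> \<and>
      v \<in> controls T Q \<and> motion1 f g t0 x0 strategy r \<tau> v x}. z \<le> ereal (c (J0 t0 x0) + e)"
    using \<epsilon>(2) by (intro exI[of _ \<delta>]) auto
next
  fix \<delta> \<delta>' :: real assume "\<delta> \<le> \<delta>'"
  then have "mesh r \<tau> \<le> \<delta>'" if "mesh r \<tau> \<le> \<delta>" for r \<tau> using that by simp
  then show "{ereal (\<sigma> (x T)) | x r \<tau> v. is_partition t0 T r \<tau> \<and> mesh r \<tau> \<le> \<delta> \<and> v \<in> controls T Q \<and>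
      motion1 f g t0 x0 strategy r \<tau> v x}
    \<subseteq> {ereal (\<sigma> (x T)) | x r \<tau> v. is_partition t0 T r \<tau> \<and> mesh r \<tau> \<le> \<delta>' \<and> v \<in> controls T Q \<and>
      motion1 f g t0 x0 strategy r \<tau> v x}"
    by blast
qed

end

section \<open>Joint play\<close>

locale game = I: tracking T K P Q f g S plan snd J0 R \<phi> + II: tracking T K Q P g f S plan fst J0 R \<phi>
  for T K :: real
    and P :: "'p::metric_space set" and Q :: "'q::metric_space set"
    and f :: "real \<Rightarrow> 'x::euclidean_space \<Rightarrow> 'p \<Rightarrow> 'x"
    and g :: "real \<Rightarrow> 'x \<Rightarrow> 'q \<Rightarrow> 'x"
    and S plan J0 R \<phi>
begin

text \<open>Both strategies start from the same guide value and update it by the same rule as long as no alarm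
is raised. Since both controls are extremal against all of \<open>P\<close> and \<open>Q\<close>, the squared distance obeys the
recursion that defines \<open>D\<close>; so no alarm occurs at the next node either.\<close>

lemma agreement:
  assumes part: "is_partition t0 T r \<tau>" "mesh r \<tau> \<le> \<delta>" and "0 \<le> t0" and "0 \<le> \<epsilon>"
    and \<phi>: "\<And>h. \<lbrakk>0 < h; h \<le> \<delta>\<rbrakk> \<Longrightarrow> \<phi> h \<le> \<epsilon> \<and> shift_bound T K P Q f g R h (\<phi> h)"
    and x: "motionc f g t0 x0 I.strategy II.strategy r \<tau> x"
    and x0: "(1 + norm x0) * exp (2 * K * T) \<le> 1 + R"
  obtains w where "J0 t0 x0 \<in> S T w" "norm w \<le> R" "norm (x T) \<le> R"
    "(norm (x T - w))\<^sup>2 \<le> exp (4 * K * (T - t0)) * ((T - t0) * \<epsilon>)"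
proof -
  define J where "J = J0 t0 x0"
  define b where "b t = (1 + norm x0) * exp (2 * K * (t - t0))" for t
  have b_le: "b t \<le> 1 + R" if "t \<le> T" for t
  proof -
    have "b t \<le> (1 + norm x0) * exp (2 * K * T)"
      unfolding b_def using that I.K_nonneg \<open>0 \<le> t0\<close> by (intro mult_left_mono) (auto intro: mult_left_mono)
    then show ?thesis using x0 by simp
  qed
  have b_step: "b s * exp (2 * K * (t - s)) = b t" for s t
    unfolding b_def by (simp add: exp_add[symmetric] algebra_simps)
  have xt0: "x t0 = x0" and \<tau>0: "\<tau> 0 = t0" and \<tau>r: "\<tau> r = T"
    using x part by (auto simp: motionc_def is_partition_def)
  have inv: "k \<le> r \<Longrightarrow> \<exists>D w. I.state \<tau> x k = (False, D, J, w) \<and> II.state \<tau> x k = (False, D, J, w) \<and>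
      J \<in> S (\<tau> k) w \<and> 1 + norm w \<le> b (\<tau> k) \<and> 1 + norm (x (\<tau> k)) \<le> b (\<tau> k) \<and>
      (norm (x (\<tau> k) - w))\<^sup>2 \<le> D \<and> D \<le> exp (4 * K * (\<tau> k - t0)) * (1 * (\<tau> k - t0) * \<epsilon> + 0)" for k
  proof (induction k)
    case 0
    have "J0 t0 x0 \<in> S t0 x0"
      using I.selector[of t0] partition_bounds[OF part(1), of 0] \<tau>0 \<open>0 \<le> t0\<close> by auto
    then show ?case unfolding I.state_0 II.state_0 \<tau>0 xt0 J_def by (auto simp: b_def)
  next
    case (Suc k)
    define s t where "s = \<tau> k" and "t = \<tau> (Suc k)"
    define a where "a = s - t0"
    have st: "0 < t - s" "t - s \<le> \<delta>"
      using partition_step[OF part, of k] Suc.prems by (auto simp: s_def t_def)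
    have a: "0 \<le> a" and s0: "0 \<le> s" and tT: "t \<le> T"
      using partition_bounds[OF part(1), of k] partition_bounds[OF part(1), of "Suc k"] Suc.prems \<open>0 \<le> t0\<close>
      by (auto simp: a_def s_def t_def)
    have ta: "t - t0 = a + (t - s)" by (simp add: a_def)
    obtain D w where ih: "I.state \<tau> x k = (False, D, J, w)" "II.state \<tau> x k = (False, D, J, w)"
      "J \<in> S s w" "1 + norm w \<le> b s" "1 + norm (x s) \<le> b s"
      "(norm (x s - w))\<^sup>2 \<le> D" "D \<le> exp (4 * K * a) * (1 * a * \<epsilon> + 0)"
      using Suc by (auto simp: s_def a_def)
    have R: "norm w \<le> R" "norm (x s) \<le> R"
      using ih(4,5) b_le[of s] st tT by auto
    have "solves_on f g (\<lambda>_. step_ctrl I.strategy \<tau> x k) (\<lambda>_. step_ctrl II.strategy \<tau> x k)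
        (\<tau> k) (\<tau> (Suc k)) x"
      using x Suc.prems by (simp add: motionc_def)
    then have xs: "solves_on f g (\<lambda>_. I.aim s (x s) w) (\<lambda>_. II.aim s (x s) w) s t x"
      unfolding I.step_ctrl_strategy[OF ih(1)] II.step_ctrl_strategy[OF ih(2)] s_def t_def .
    have s: "s \<in> {0..T}" using s0 st tT by auto
    have bound: "\<phi> (t - s) \<le> \<epsilon>" "shift_bound T K P Q f g R (t - s) (\<phi> (t - s))"
      using \<phi>[OF st] by auto
    define w' where "w' = plan t s w J"
    have w': "w' \<in> attainable f g P Q s w t" "J \<in> S t w'"
      using I.plan[OF s0 _ tT ih(3)] st by (auto simp: w'_def)
    let ?D' = "(1 + 4 * K * (t - s)) * D + (t - s) * \<phi> (t - s)"
    have "1 + norm (x t) \<le> (1 + norm (x s)) * exp (2 * K * (t - s))"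
      using s0 st tT I.aim(1)[OF s] II.aim(1)[OF s] by (intro I.solution_growth[OF xs]) auto
    also have "\<dots> \<le> b s * exp (2 * K * (t - s))" using ih(5) by (intro mult_right_mono) auto
    finally have xt: "1 + norm (x t) \<le> b t" using b_step by simp
    have "1 + norm w' \<le> (1 + norm w) * exp (2 * K * (t - s))"
      using s0 st tT by (intro I.attainable_growth[OF w'(1)]) auto
    also have "\<dots> \<le> b s * exp (2 * K * (t - s))" using ih(4) by (intro mult_right_mono) auto
    finally have wt: "1 + norm w' \<le> b t" using b_step by simp
    have "(norm (x t - w'))\<^sup>2 \<le> (1 + 4 * K * (t - s)) * (norm (x s - w))\<^sup>2 + (t - s) * \<phi> (t - s)"
      using bound(2)[unfolded shift_bound_def, rule_format,
          of s x w P Q "\<lambda>_. I.aim s (x s) w" "\<lambda>_. II.aim s (x s) w" w']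
        s0 st tT R w'(1) xs I.aim[OF s] II.aim[OF s] by auto
    also have "\<dots> \<le> ?D'"
      using ih(6) I.K_nonneg st by (intro add_right_mono mult_left_mono) auto
    finally have 1: "(norm (x t - w'))\<^sup>2 \<le> ?D'" .
    have "?D' \<le> (1 + 4 * K * (t - s)) * (exp (4 * K * a) * (1 * a * \<epsilon> + 0)) + (t - s) * \<epsilon>"
      using ih(7) bound(1) I.K_nonneg st by (intro add_mono mult_left_mono) auto
    also have "\<dots> \<le> exp (4 * K * (t - t0)) * (1 * (t - t0) * \<epsilon> + 0)"
      unfolding ta using I.K_nonneg st a \<open>0 \<le> \<epsilon>\<close> by (intro error_accumulation) auto
    finally have 2: "?D' \<le> exp (4 * K * (t - t0)) * (1 * (t - t0) * \<epsilon> + 0)" .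
    have "I.state \<tau> x (Suc k) = (False, ?D', J, w')" "II.state \<tau> x (Suc k) = (False, ?D', J, w')"
      using ih(6) unfolding I.state_Suc II.state_Suc ih(1,2) I.advance_def II.advance_def w'_def s_def t_def
      by auto
    then show ?case using w'(2) xt wt 1 2 unfolding t_def by blast
  qed
  from inv[of r] obtain D w where "J \<in> S T w" "1 + norm w \<le> b T" "1 + norm (x T) \<le> b T"
    "(norm (x T - w))\<^sup>2 \<le> D" "D \<le> exp (4 * K * (T - t0)) * (1 * (T - t0) * \<epsilon> + 0)"
    unfolding \<tau>r by auto
  then show thesis using that[of w] b_le[of T] unfolding J_def by auto
qed

lemma consistent_payoff_eq:
  assumes \<sigma>: "continuous_on UNIV \<sigma>" "\<And>J w. J \<in> S T w \<Longrightarrow> c J = \<sigma> w"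
    and "t0 \<in> {0..T}" "(1 + norm x0) * exp (2 * K * T) \<le> 1 + R"
  shows "consistent_payoff T f g \<sigma> I.strategy II.strategy t0 x0 = ereal (c (J0 t0 x0))"
  unfolding consistent_payoff_def
proof (rule Lim_Inf_eq)
  fix e :: real assume "0 < e"
  obtain \<epsilon> \<delta> where \<epsilon>: "0 < \<epsilon>" "0 < \<delta>"
    "\<And>h. \<lbrakk>0 < h; h \<le> \<delta>\<rbrakk> \<Longrightarrow> \<phi> h \<le> \<epsilon> \<and> shift_bound T K P Q f g R h (\<phi> h)"
    "\<And>t0 x w. \<lbrakk>0 \<le> t0; t0 \<le> T; norm x \<le> R; norm w \<le> R;
       (norm (x - w))\<^sup>2 \<le> exp (4 * K * (T - t0)) * (2 * (T - t0) * \<epsilon> + 8 * (speed T K R * \<delta>)\<^sup>2)\<rbrakk>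
       \<Longrightarrow> \<bar>\<sigma> x - \<sigma> w\<bar> \<le> e"
    using I.payoff_near_guide[OF \<sigma>(1) \<open>0 < e\<close>] by metis
  have "\<bar>\<sigma> (x T) - c (J0 t0 x0)\<bar> \<le> e"
    if m: "is_partition t0 T r \<tau>" "mesh r \<tau> \<le> \<delta>"
      "motionc f g t0 x0 I.strategy II.strategy r \<tau> x" for x r \<tau>
  proof -
    obtain w where w: "J0 t0 x0 \<in> S T w" "norm w \<le> R" "norm (x T) \<le> R"
      "(norm (x T - w))\<^sup>2 \<le> exp (4 * K * (T - t0)) * ((T - t0) * \<epsilon>)"
      using agreement[OF m(1,2) _ _ \<epsilon>(3) m(3) assms(4)] \<epsilon>(1) assms(3)
      by (metis atLeastAtMost_iff less_imp_le)
    have "0 \<le> (T - t0) * \<epsilon>" "0 \<le> 8 * (speed T K R * \<delta>)\<^sup>2" using assms(3) \<epsilon>(1) by auto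
    then have "(T - t0) * \<epsilon> \<le> 2 * (T - t0) * \<epsilon> + 8 * (speed T K R * \<delta>)\<^sup>2"
      unfolding mult.assoc[of 2] by linarith
    then have "exp (4 * K * (T - t0)) * ((T - t0) * \<epsilon>)
        \<le> exp (4 * K * (T - t0)) * (2 * (T - t0) * \<epsilon> + 8 * (speed T K R * \<delta>)\<^sup>2)"
      by (intro mult_left_mono) auto
    note close = order_trans[OF w(4) this]
    have "\<bar>\<sigma> (x T) - \<sigma> w\<bar> \<le> e"
      by (rule \<epsilon>(4)[OF _ _ w(3,2) close]) (use assms(3) in auto)
    then show ?thesis using \<sigma>(2)[OF w(1)] by simp
  qed
  then show "\<exists>\<delta>>0. \<forall>z\<in>{ereal (\<sigma> (x T)) | x r \<tau>. is_partition t0 T r \<tau> \<and> mesh r \<tau> \<le> \<delta> \<and>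
      motionc f g t0 x0 I.strategy II.strategy r \<tau> x}.
      ereal (c (J0 t0 x0) - e) \<le> z \<and> z \<le> ereal (c (J0 t0 x0) + e)"
    using \<epsilon>(2) by (intro exI[of _ \<delta>]) (fastforce simp: abs_le_iff)
next
  fix \<delta> :: real assume "0 < \<delta>"
  define \<delta>' where "\<delta>' = min \<delta> (1 / (4 * (K + 1)))"
  have \<delta>': "0 < \<delta>'" using \<open>0 < \<delta>\<close> I.K_nonneg by (auto simp: \<delta>'_def)
  obtain r \<tau> where part: "is_partition t0 T r \<tau>" "mesh r \<tau> \<le> \<delta>'"
    using fine_partition_exists[OF _ \<delta>', of t0 T] assms(3) by auto
  have "2 * K * (\<tau> (Suc k) - \<tau> k) < 1" if "k < r" for k
  proof -
    have "2 * K * (\<tau> (Suc k) - \<tau> k) \<le> 2 * K * (1 / (4 * (K + 1)))"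
      using partition_step[OF part that] I.K_nonneg by (intro mult_left_mono) (auto simp: \<delta>'_def)
    also have "\<dots> < 1" using I.K_nonneg by (simp add: field_simps)
    finally show ?thesis .
  qed
  then obtain x where "motionc f g t0 x0 I.strategy II.strategy r \<tau> x"
    using I.motionc_exists[OF I.control_with_guide_strategy II.control_with_guide_strategy part(1)] assms(3)
    by auto
  moreover have "mesh r \<tau> \<le> \<delta>" using part(2) by (simp add: \<delta>'_def)
  ultimately show "{ereal (\<sigma> (x T)) | x r \<tau>. is_partition t0 T r \<tau> \<and> mesh r \<tau> \<le> \<delta> \<and>
      motionc f g t0 x0 I.strategy II.strategy r \<tau> x} \<noteq> {}"
    using part(1) by blast
next
  fix \<delta> \<delta>' :: real assume "\<delta> \<le> \<delta>'"
  then have "mesh r \<tau> \<le> \<delta>'" if "mesh r \<tau> \<le> \<delta>" for r \<tau> using that by simp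
  then show "{ereal (\<sigma> (x T)) | x r \<tau>. is_partition t0 T r \<tau> \<and> mesh r \<tau> \<le> \<delta> \<and> 
      motionc f g t0 x0 I.strategy II.strategy r \<tau> x}
    \<subseteq> {ereal (\<sigma> (x T)) | x r \<tau>. is_partition t0 T r \<tau> \<and> mesh r \<tau> \<le> \<delta>' \<and> 
      motionc f g t0 x0 I.strategy II.strategy r \<tau> x}"
    by blast
qed

end

section \<open>The equilibrium\<close>

text \<open>The constant may be enlarged, which allows \<open>f\<close> and \<open>g\<close> to share one.\<close>

lemma common_constant:
  assumes "lipschitz_in_state T P f" "sublinear_growth T P f"
  obtains K where "0 \<le> K"
    and "\<And>t u x y K'. \<lbrakk>t \<in> {0..T}; u \<in> P; K \<le> K'\<rbrakk> \<Longrightarrow> norm (f t x u - f t y u) \<le> K' * norm (x - y)"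
    and "\<And>t u x K'. \<lbrakk>t \<in> {0..T}; u \<in> P; K \<le> K'\<rbrakk> \<Longrightarrow> norm (f t x u) \<le> K' * (1 + norm x)"
proof -
  obtain L where L: "\<And>t u. \<lbrakk>t \<in> {0..T}; u \<in> P\<rbrakk> \<Longrightarrow> L-lipschitz_on UNIV (\<lambda>x. f t x u)"
    using assms(1) unfolding lipschitz_in_state_def by blast
  obtain C where C: "\<And>t u x. \<lbrakk>t \<in> {0..T}; u \<in> P\<rbrakk> \<Longrightarrow> norm (f t x u) \<le> C * (1 + norm x)"
    using assms(2) unfolding sublinear_growth_def by blast
  show thesis
  proof (rule that[of "max 0 (max L C)"])
    fix t u x y K' assume *: "t \<in> {0..T}" "u \<in> P" "max 0 (max L C) \<le> K'"
    have "norm (f t x u - f t y u) \<le> L * norm (x - y)"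
      using lipschitz_onD[OF L[OF *(1,2)], of x y] by (simp add: dist_norm)
    also have "\<dots> \<le> K' * norm (x - y)" using * by (intro mult_right_mono) auto
    finally show "norm (f t x u - f t y u) \<le> K' * norm (x - y)" .
    note C[OF *(1,2), of x]
    also have "C * (1 + norm x) \<le> K' * (1 + norm x)" using * by (intro mult_right_mono) auto
    finally show "norm (f t x u) \<le> K' * (1 + norm x)" .
  qed auto
qed

theorem theorem4p1:
  fixes T :: real
    and P :: "'p::metric_space set" and Q :: "'q::metric_space set"
    and f :: "real \<Rightarrow> real ^ 'n \<Rightarrow> 'p \<Rightarrow> real ^ 'n"
    and g :: "real \<Rightarrow> real ^ 'n \<Rightarrow> 'q \<Rightarrow> real ^ 'n"
    and \<sigma>1 \<sigma>2 :: "real ^ 'n \<Rightarrow> real"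
    and S :: "real \<Rightarrow> real ^ 'n \<Rightarrow> (real \<times> real) set"
    and J1hat J2hat :: "real \<Rightarrow> real ^ 'n \<Rightarrow> real"
    and G :: "(real \<times> (real ^ 'n)) set"
  assumes T: "0 \<le> T"
    and P: "compact P" "P \<noteq> {}" and Q: "compact Q" "Q \<noteq> {}"
    and f: "continuous_on ({0..T} \<times> UNIV \<times> P) (\<lambda>(t, x, u). f t x u)"
      "lipschitz_in_state T P f" "sublinear_growth T P f"
    and g: "continuous_on ({0..T} \<times> UNIV \<times> Q) (\<lambda>(t, x, v). g t x v)"
      "lipschitz_in_state T Q g" "sublinear_growth T Q g"
    and \<sigma>: "continuous_on UNIV \<sigma>1" "continuous_on UNIV \<sigma>2"
    and S_usc: "closed_graph_on T S"
    and S_nonempty: "\<forall>t\<in>{0..T}. \<forall>x. S t x \<noteq> {}"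
    and S1: "\<forall>x. S T x = {(\<sigma>1 x, \<sigma>2 x)}"
    and S2: "\<forall>t\<in>{0..T}. \<forall>x. \<forall>(J1, J2)\<in>S t x. \<forall>u\<in>P. \<forall>t'\<in>{t..T}.
      \<exists>y\<in>Sol2 T f g Q t x u. \<exists>(J1', J2')\<in>S t' (y t'). J1 \<ge> J1'"
    and S3: "\<forall>t\<in>{0..T}. \<forall>x. \<forall>(J1, J2)\<in>S t x. \<forall>v\<in>Q. \<forall>t'\<in>{t..T}.
      \<exists>y\<in>Sol1 T f g P t x v. \<exists>(J1', J2')\<in>S t' (y t'). J2 \<ge> J2'"
    and S4: "\<forall>t\<in>{0..T}. \<forall>x. \<forall>(J1, J2)\<in>S t x. \<forall>t'\<in>{t..T}.
      \<exists>y\<in>Sol T f g P Q t x. (J1, J2) \<in> S t' (y t')"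
    and selector: "\<forall>t\<in>{0..T}. \<forall>x. (J1hat t x, J2hat t x) \<in> S t x"
    and G: "compact G" "G \<subseteq> {0..T} \<times> UNIV"
  shows "\<exists>U V. guide_nash_equilibrium T f g P Q \<sigma>1 \<sigma>2 G U V \<and>
    (\<forall>(t0, x0)\<in>G. nash_payoff T f g \<sigma>1 \<sigma>2 U V t0 x0 =
      (ereal (J1hat t0 x0), ereal (J2hat t0 x0)))"
proof -
  obtain K1 where K1: "0 \<le> K1"
    "\<And>t u x y K'. \<lbrakk>t \<in> {0..T}; u \<in> P; K1 \<le> K'\<rbrakk> \<Longrightarrow> norm (f t x u - f t y u) \<le> K' * norm (x - y)"
    "\<And>t u x K'. \<lbrakk>t \<in> {0..T}; u \<in> P; K1 \<le> K'\<rbrakk> \<Longrightarrow> norm (f t x u) \<le> K' * (1 + norm x)"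
    using common_constant[OF f(2,3)] by metis
  obtain K2 where K2: "0 \<le> K2"
    "\<And>t u x y K'. \<lbrakk>t \<in> {0..T}; u \<in> Q; K2 \<le> K'\<rbrakk> \<Longrightarrow> norm (g t x u - g t y u) \<le> K' * norm (x - y)"
    "\<And>t u x K'. \<lbrakk>t \<in> {0..T}; u \<in> Q; K2 \<le> K'\<rbrakk> \<Longrightarrow> norm (g t x u) \<le> K' * (1 + norm x)"
    using common_constant[OF g(2,3)] by metis
  define K where "K = max K1 K2"
  interpret I: controlled_system T K P Q f g
    by unfold_locales (use T P Q f(1) g(1) K1 K2 in \<open>auto simp: K_def\<close>)
  interpret II: controlled_system T K Q P g f by (rule I.swapped)
  obtain r where r: "0 \<le> r" "\<And>t x. (t, x) \<in> G \<Longrightarrow> norm x \<le> r"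
  proof -
    have "bounded (snd ` G)" using G(1) by (intro bounded_snd compact_imp_bounded)
    then obtain r where "\<And>z. z \<in> snd ` G \<Longrightarrow> norm z \<le> r" unfolding bounded_iff by blast
    then show thesis by (intro that[of "max 0 r"]) force+
  qed
  \<comment> \<open>a radius that motions from G and their guides do not leave\<close>
  define R where "R = (1 + r) * exp (2 * K * T) - 1"
  have "1 * 1 \<le> (1 + r) * exp (2 * K * T)"
    using r(1) T I.K_nonneg by (intro mult_mono) auto
  then have R: "0 \<le> R" by (simp add: R_def)
  obtain \<phi> where \<phi>: "\<And>\<epsilon>. 0 < \<epsilon> \<Longrightarrow>
      \<exists>\<delta>>0. \<forall>h. 0 < h \<longrightarrow> h \<le> \<delta> \<longrightarrow> \<phi> h \<le> \<epsilon> \<and> shift_bound T K P Q f g R h (\<phi> h)"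
    using I.error_rate_exists[OF R] by metis
  define plan where "plan t' t w J = (SOME w'. w' \<in> attainable f g P Q t w t' \<and> J \<in> S t' w')"
    for t' t w J
  have plan: "plan t' t w J \<in> attainable f g P Q t w t' \<and> J \<in> S t' (plan t' t w J)"
    if "0 \<le> t" "t \<le> t'" "t' \<le> T" "J \<in> S t w" for t' t w J
    unfolding plan_def
  proof (rule someI_ex)
    have "(case J of (J1, J2) \<Rightarrow> \<forall>t'\<in>{t..T}. \<exists>y\<in>Sol T f g P Q t w. (J1, J2) \<in> S t' (y t'))"
      using S4 that by (metis (no_types, lifting) atLeastAtMost_iff order_trans)
    then have "\<exists>y\<in>Sol T f g P Q t w. J \<in> S t' (y t')" using that by (auto split: prod.splits)
    then show "\<exists>w'. w' \<in> attainable f g P Q t w t' \<and> J \<in> S t' w'"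
      using Sol_subset_attainable that by blast
  qed
  have pun1: "\<exists>w'\<in>attainable f g P {v} t w t'. \<exists>J'\<in>S t' w'. snd J' \<le> snd J"
    if h: "0 \<le> t" "t \<le> t'" "t' \<le> T" "J \<in> S t w" "v \<in> Q" for t t' J w v
  proof -
    obtain J1 J2 where J: "J = (J1, J2)" by fastforce
    have "t \<in> {0..T}" "t' \<in> {t..T}" using h by auto
    then obtain y J' where y: "y \<in> Sol1 T f g P t w v" "J' \<in> S t' (y t')" "snd J' \<le> J2"
      using S3 h(4,5) unfolding J by fastforce
    have "y t' \<in> attainable f g P {v} t w t'"
      using Sol2_subset_attainable[of y T g f P t w v t'] y(1) h
      unfolding Sol1_eq_Sol2 attainable_commute[of g f] by auto
    then show ?thesis using y J by auto
  qed
  have pun2: "\<exists>w'\<in>attainable g f Q {u} t w t'. \<exists>J'\<in>S t' w'. fst J' \<le> fst J"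
    if h: "0 \<le> t" "t \<le> t'" "t' \<le> T" "J \<in> S t w" "u \<in> P" for t t' J w u
  proof -
    obtain J1 J2 where J: "J = (J1, J2)" by fastforce
    have "t \<in> {0..T}" "t' \<in> {t..T}" using h by auto
    then obtain y J' where y: "y \<in> Sol2 T f g Q t w u" "J' \<in> S t' (y t')" "fst J' \<le> J1"
      using S2 h(4,5) unfolding J by fastforce
    have "y t' \<in> attainable g f Q {u} t w t'"
      using Sol2_subset_attainable[OF y(1)] h unfolding attainable_commute[of g f] by auto
    then show ?thesis using y J by auto
  qed
  define J0 where "J0 t x = (J1hat t x, J2hat t x)" for t x
  have J0: "J0 t x \<in> S t x" if "t \<in> {0..T}" for t x using selector that by (simp add: J0_def)
  interpret game T K P Q f g S plan J0 R \<phi>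
  proof (intro game.intro tracking.intro tracking_axioms.intro I.swapped)
    show "controlled_system T K P Q f g" by unfold_locales
    fix \<epsilon> :: real assume "0 < \<epsilon>"
    then show "\<exists>\<delta>>0. \<forall>h. 0 < h \<longrightarrow> h \<le> \<delta> \<longrightarrow> \<phi> h \<le> \<epsilon> \<and> shift_bound T K Q P g f R h (\<phi> h)"
      using \<phi>[of \<epsilon>] shift_bound_commute by metis
  qed (use plan pun1 pun2 J0 R \<phi> in \<open>auto simp: attainable_commute[of g f]\<close>)
  have start: "t0 \<in> {0..T} \<and> (1 + norm x0) * exp (2 * K * T) \<le> 1 + R" if "(t0, x0) \<in> G" for t0 x0
    using r(2)[OF that] G(2) that by (auto simp: R_def)
  have final1: "fst J = \<sigma>1 w" and final2: "snd J = \<sigma>2 w" if "J \<in> S T w" for J w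
    using S1 that by auto
  have consistent: "consistent_payoff T f g \<sigma>1 I.strategy II.strategy t0 x0 = ereal (J1hat t0 x0)"
    "consistent_payoff T f g \<sigma>2 I.strategy II.strategy t0 x0 = ereal (J2hat t0 x0)" if "(t0, x0) \<in> G" for t0 x0
    using consistent_payoff_eq[of \<sigma>1 fst] consistent_payoff_eq[of \<sigma>2 snd] \<sigma> final1 final2 start[OF that]
    by (auto simp: J0_def)
  have deviation: "payoff_vs2 T f g P \<sigma>1 II.strategy t0 x0 \<le> ereal (J1hat t0 x0)"
    "payoff_vs1 T f g Q \<sigma>2 I.strategy t0 x0 \<le> ereal (J2hat t0 x0)" if "(t0, x0) \<in> G" for t0 x0
    using II.deviation_payoff_le[OF \<sigma>(1) final1] I.deviation_payoff_le[OF \<sigma>(2) final2] start[OF that]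
    unfolding payoff_vs2_eq_payoff_vs1 by (auto simp: J0_def)
  show ?thesis
  proof (intro exI conjI)
    show "guide_nash_equilibrium T f g P Q \<sigma>1 \<sigma>2 G I.strategy II.strategy"
      unfolding guide_nash_equilibrium_def
      using I.control_with_guide_strategy II.control_with_guide_strategy consistent deviation by auto
    show "\<forall>(t0, x0)\<in>G. nash_payoff T f g \<sigma>1 \<sigma>2 I.strategy II.strategy t0 x0 =
        (ereal (J1hat t0 x0), ereal (J2hat t0 x0))"
      unfolding nash_payoff_def using consistent by auto
  qed
qed

end
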